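(* Let $\mathcal{B}$ be a decorated bicategory. Then $Q_\mathcal{B}$ is an internalization of $H^*Q_\mathcal{B}$.
   Context: Double category means pseudo double category: categories $C_0,C_1$, functors $s,t:C_1\to C_0$, $i:C_0\to C_1$, $\ast:C_1\times_{C_0}C_1\to C_1$ (sending a pair $(\Phi,\Psi)$ with $t\Phi=s\Psi$ to $\Psi\ast\Phi$), with natural globular isomorphisms $\lambda,\rho,A$ satisfying the usual coherence axioms. Objects of $C_1$ are horizontal morphisms, morphisms of $C_1$ are squares (composition in $C_1$ is vertical composition). A square is globular if its images under $s$ and $t$ are identities. The horizontal bicategory $HC$ has the objects of $C_0$ as 0-cells, horizontal morphisms as 1-cells and globular squares as 2-cells. A decorated bicategory is a bicategory $\mathcal{B}$ (with collections $\mathcal{B}_0,\mathcal{B}_1,\mathcal{B}_2$ of 0-, 1-, 2-cells, horizontal composition $\ast$, horizontal identity 1-cells $i_a$, identity transformations $\lambda,\rho$, and associator $A$ with components $f(gh)\to(fg)h$) together with a category $\mathcal{B}^*$ (the decoration) whose collection of objects is $\mathcal{B}_0$. The decorated horizontalization of a double category $C$ is the decorated bicategory $H^*C=(C_0,HC)$. An internalization of a decorated bicategory $\mathcal{D}$ is a double category $C$ such that $H^*C=\mathcal{D}$. The free globularily generated double category $Q_\mathcal{B}$. Let $\mathbb{G}$ be the union of the collection of 2-cells of $\mathcal{B}$ and the collection of formal symbols $i_f$, one for each morphism $f$ of $\mathcal{B}^*$. For a 2-cell $\varphi:\alpha\Rightarrow\beta$ with $\alpha,\beta:a\to b$, put $d\varphi=\alpha$,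 $c\varphi=\beta$, $s\varphi=id_a$, $t\varphi=id_b$ (identities in $\mathcal{B}^*$). For $f:a\to b$ in $\mathcal{B}^*$ put $d(i_f)=i_a$, $c(i_f)=i_b$, $s(i_f)=t(i_f)=f$. Let $E_1$ be the set of all parenthesized words $x_n\cdots x_1$ ($n\ge1$) in $\mathbb{G}$ with $tx_j=sx_{j+1}$; $d$ and $c$ of such a word are the composites in $\mathcal{B}_1$ of the $d x_j$, resp. $c x_j$, following the same parenthesization; $s$ is $sx_1$ and $t$ is $tx_n$. Let $F_1$ be the free (path) category with objects $\mathcal{B}_1$ generated by $E_1$ with domain $d$ and codomain $c$; $s,t$ extend to functors $F_1\to\mathcal{B}^*$ (on objects: domain and codomain of 1-cells). Inductively $E_{k+1}$ is the set of parenthesized words $x_n\cdots x_1$ in $\mathrm{Hom}_{F_k}$ with $tx_j=sx_{j+1}$, with $d,c,s,t$ defined in the same way, and $F_{k+1}$ is the free category with objects $\mathcal{B}_1$ generated by $E_{k+1}$. Regard $E_k\subseteq\mathrm{Hom}_{F_k}\subseteq E_{k+1}$ via paths of length one and words of length one, and let $E_\infty=\bigcup_kE_k$, the set of morphisms of the limit category $F_\infty=\varinjlim F_k$; denote by $d_\infty,c_\infty,s_\infty,t_\infty$ the resulting boundary maps, by $\bullet_\infty$ the (vertical) composition and by $\ast_\infty$ the concatenation $(\Phi,\Psi)\mapsto\Psi\ast_\infty\Phi$, defined when $t_\infty\Phi=s_\infty\Psi$ (formal composites which differ only through the inclusions $E_k\subseteq\mathrm{Hom}_{F_k}\subseteq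 E_{k+1}$ are identified). $R_\infty$ is the smallest equivalence relation on $E_\infty$ compatible with $\bullet_\infty$ and $\ast_\infty$ such that, whenever the expressions are defined: (1) $(\Psi_2\ast_\infty\Psi_1)\bullet_\infty(\Phi_2\ast_\infty\Phi_1)\sim(\Psi_2\bullet_\infty\Phi_2)\ast_\infty(\Psi_1\bullet_\infty\Phi_1)$; (2) $\Psi\bullet_\infty\Phi\sim\Psi\Phi$ (vertical composition in $\mathcal{B}$) for vertically composable 2-cells $\Phi,\Psi$ of $\mathcal{B}$, and $i_g\bullet_\infty i_f\sim i_{gf}$ for composable morphisms $f,g$ of $\mathcal{B}^*$; also identities agree: the identity morphism of $F_\infty$ at a 1-cell $\alpha$ is identified with the identity 2-cell of $\alpha$, and $i_{id_a}$ with the identity 2-cell of the 1-cell $i_a$; (3) $\Psi\ast_\infty\Phi\sim\Psi\ast\Phi$ (horizontal composition in $\mathcal{B}$) for horizontally composable 2-cells of $\mathcal{B}$; (4) $\Phi\sim\lambda_{c_\infty\Phi}\bullet_\infty(i_{t_\infty\Phi}\ast_\infty\Phi)\bullet_\infty\lambda_{d_\infty\Phi}^{-1}$ and $\Phi\sim\rho_{c_\infty\Phi}\bullet_\infty(\Phi\ast_\infty i_{s_\infty\Phi})\bullet_\infty\rho_{d_\infty\Phi}^{-1}$; (5) $A\bullet_\infty[\Theta\ast_\infty(\Psi\ast_\infty\Phi)]\sim[(\Theta\ast_\infty\Psi)\ast_\infty\Phi]\bullet_\infty A$, where the two $A$'s are the associator components at the codomains, respectively the domains, of $\Phi,\Psi,\Theta$.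 $V_\infty=F_\infty/R_\infty$, and $Q_\mathcal{B}$ is the double category with category of objects $\mathcal{B}^*$, category of squares $V_\infty$, source, target and horizontal composition functors induced by $s_\infty,t_\infty,\ast_\infty$, horizontal identity functor $a\mapsto i_a$, $f\mapsto[i_f]$, and $\lambda,\rho,A$ those of $\mathcal{B}$. *)

theory Defs
  imports Main
begin

section \<open>Categories and functors\<close>

text \<open>All structures are carrier-based: operations are total HOL functions, and only their values
  on the carriers (and on composable pairs) are meaningful.\<close>

record ('o, 'a) cat =
  Obj :: "'o set"
  Arr :: "'a set"
  Dom :: "'a \<Rightarrow> 'o"
  Cod :: "'a \<Rightarrow> 'o"
  Ident :: "'o \<Rightarrow> 'a"
  Comp :: "'a \<Rightarrow> 'a \<Rightarrow> 'a"  (infixl "\<cdot>\<index>" 70)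

definition in_hom :: "('o, 'a, 'z) cat_scheme \<Rightarrow> 'a \<Rightarrow> 'o \<Rightarrow> 'o \<Rightarrow> bool" where
  "in_hom C f a b \<longleftrightarrow> f \<in> Arr C \<and> Dom C f = a \<and> Cod C f = b"

locale category =
  fixes C :: "('o, 'a) cat" (structure)
  assumes Dom_Obj: "f \<in> Arr C \<Longrightarrow> Dom C f \<in> Obj C"
    and Cod_Obj: "f \<in> Arr C \<Longrightarrow> Cod C f \<in> Obj C"
    and Ident_hom: "a \<in> Obj C \<Longrightarrow> in_hom C (Ident C a) a a"
    and Comp_hom: "f \<in> Arr C \<Longrightarrow> g \<in> Arr C \<Longrightarrow> Cod C f = Dom C g
      \<Longrightarrow> in_hom C (g \<cdot> f) (Dom C f) (Cod C g)"
    and Comp_Ident_left: "f \<in> Arr C \<Longrightarrow> Ident C (Cod C f) \<cdot> f = f"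
    and Comp_Ident_right: "f \<in> Arr C \<Longrightarrow> f \<cdot> Ident C (Dom C f) = f"
    and Comp_assoc: "f \<in> Arr C \<Longrightarrow> g \<in> Arr C \<Longrightarrow> h \<in> Arr C
      \<Longrightarrow> Cod C f = Dom C g \<Longrightarrow> Cod C g = Dom C h \<Longrightarrow> (h \<cdot> g) \<cdot> f = h \<cdot> (g \<cdot> f)"

definition inverse_arrows :: "('o, 'a) cat \<Rightarrow> 'a \<Rightarrow> 'a \<Rightarrow> bool" where
  "inverse_arrows C f g \<longleftrightarrow> in_hom C f (Dom C f) (Cod C f) \<and> in_hom C g (Cod C f) (Dom C f) \<and>
     Comp C g f = Ident C (Dom C f) \<and> Comp C f g = Ident C (Cod C f)"

definition iso_arr :: "('o, 'a) cat \<Rightarrow> 'a \<Rightarrow> bool" where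
  "iso_arr C f \<longleftrightarrow> (\<exists>g. inverse_arrows C f g)"

definition inv_arr :: "('o, 'a) cat \<Rightarrow> 'a \<Rightarrow> 'a" where
  "inv_arr C f = (THE g. inverse_arrows C f g)"

record ('o, 'a, 'p, 'b) ftor =
  on_obj :: "'o \<Rightarrow> 'p"
  on_arr :: "'a \<Rightarrow> 'b"

locale is_functor = C: category C + D: category D
  for C :: "('o, 'a) cat" and D :: "('p, 'b) cat" +
  fixes F :: "('o, 'a, 'p, 'b) ftor"
  assumes on_obj: "a \<in> Obj C \<Longrightarrow> on_obj F a \<in> Obj D"
    and on_arr: "f \<in> Arr C
      \<Longrightarrow> in_hom D (on_arr F f) (on_obj F (Dom C f)) (on_obj F (Cod C f))"
    and on_Ident: "a \<in> Obj C \<Longrightarrow> on_arr F (Ident C a) = Ident D (on_obj F a)"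
    and on_Comp: "f \<in> Arr C \<Longrightarrow> g \<in> Arr C \<Longrightarrow> Cod C f = Dom C g
      \<Longrightarrow> on_arr F (Comp C g f) = Comp D (on_arr F g) (on_arr F f)"

definition pullback_cat ::
  "('o, 'a) cat \<Rightarrow> ('p, 'b) cat \<Rightarrow> ('o, 'a, 'q, 'c) ftor \<Rightarrow> ('p, 'b, 'q, 'c) ftor
   \<Rightarrow> ('o \<times> 'p, 'a \<times> 'b) cat" where
  "pullback_cat C D F G =
    \<lparr>Obj = {(x, y). x \<in> Obj C \<and> y \<in> Obj D \<and> on_obj F x = on_obj G y},
     Arr = {(f, g). f \<in> Arr C \<and> g \<in> Arr D \<and> on_arr F f = on_arr G g},
     Dom = map_prod (Dom C) (Dom D),
     Cod = map_prod (Cod C) (Cod D),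
     Ident = map_prod (Ident C) (Ident D),
     Comp = (\<lambda>(f', g') (f, g). (Comp C f' f, Comp D g' g))\<rparr>"

text \<open>Quotient by a congruence on parallel arrows; arrows are equivalence classes.\<close>

definition class_rep :: "'a set \<Rightarrow> 'a" where
  "class_rep X = (SOME x. x \<in> X)"

definition quotient_cat :: "('o, 'a) cat \<Rightarrow> ('a \<times> 'a) set \<Rightarrow> ('o, 'a set) cat" where
  "quotient_cat C R =
    \<lparr>Obj = Obj C,
     Arr = Arr C // R,
     Dom = (\<lambda>X. Dom C (class_rep X)),
     Cod = (\<lambda>X. Cod C (class_rep X)),
     Ident = (\<lambda>a. R `` {Ident C a}),
     Comp = (\<lambda>Y X. R `` {Comp C (class_rep Y) (class_rep X)})\<rparr>"

section \<open>Bicategories\<close>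

text \<open>The hom-categories are presented together as one category of 1-cells and 2-cells, on which
  the 0-cell source and target are locally constant; vertical composition is its composition.
  Composition of cells is written in applicative order: \<open>hcomp1 B g f\<close> is \<open>g * f\<close>.\<close>

record ('o, 'h, 'c) bicat =
  cells0 :: "'o set"
  cells :: "('h, 'c) cat"
  src0 :: "'h \<Rightarrow> 'o"
  tgt0 :: "'h \<Rightarrow> 'o"
  hcomp1 :: "'h \<Rightarrow> 'h \<Rightarrow> 'h"
  hcomp2 :: "'c \<Rightarrow> 'c \<Rightarrow> 'c"
  hid1 :: "'o \<Rightarrow> 'h"
  blam :: "'h \<Rightarrow> 'c"
  brho :: "'h \<Rightarrow> 'c"
  bassoc :: "'h \<Rightarrow> 'h \<Rightarrow> 'h \<Rightarrow> 'c"

locale bicategory =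
  fixes B :: "('o, 'h, 'c) bicat"
  fixes V and hc1 (infixr "\<star>" 75) and hc2 (infixr "\<diamondop>" 75) and vc (infixl "\<bullet>" 70) and I
  defines "V \<equiv> cells B" and "hc1 \<equiv> hcomp1 B" and "hc2 \<equiv> hcomp2 B" and "vc \<equiv> Comp (cells B)"
    and "I \<equiv> Ident (cells B)"
  assumes cells_category: "category V"
    and src0: "f \<in> Obj V \<Longrightarrow> src0 B f \<in> cells0 B"
    and tgt0: "f \<in> Obj V \<Longrightarrow> tgt0 B f \<in> cells0 B"
    and src0_cell: "\<phi> \<in> Arr V \<Longrightarrow> src0 B (Dom V \<phi>) = src0 B (Cod V \<phi>)"
    and tgt0_cell: "\<phi> \<in> Arr V \<Longrightarrow> tgt0 B (Dom V \<phi>) = tgt0 B (Cod V \<phi>)"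
    and hcomp1: "f \<in> Obj V \<Longrightarrow> g \<in> Obj V \<Longrightarrow> tgt0 B f = src0 B g
      \<Longrightarrow> g \<star> f \<in> Obj V \<and> src0 B (g \<star> f) = src0 B f \<and> tgt0 B (g \<star> f) = tgt0 B g"
    and hcomp2: "\<phi> \<in> Arr V \<Longrightarrow> \<psi> \<in> Arr V \<Longrightarrow> tgt0 B (Dom V \<phi>) = src0 B (Dom V \<psi>)
      \<Longrightarrow> in_hom V (\<psi> \<diamondop> \<phi>) (Dom V \<psi> \<star> Dom V \<phi>) (Cod V \<psi> \<star> Cod V \<phi>)"
    and hcomp2_Ident: "f \<in> Obj V \<Longrightarrow> g \<in> Obj V \<Longrightarrow> tgt0 B f = src0 B g
      \<Longrightarrow> I g \<diamondop> I f = I (g \<star> f)"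
    and interchange: "\<phi> \<in> Arr V \<Longrightarrow> \<phi>' \<in> Arr V \<Longrightarrow> \<psi> \<in> Arr V \<Longrightarrow> \<psi>' \<in> Arr V
      \<Longrightarrow> Cod V \<phi> = Dom V \<phi>' \<Longrightarrow> Cod V \<psi> = Dom V \<psi>' \<Longrightarrow> tgt0 B (Dom V \<phi>) = src0 B (Dom V \<psi>)
      \<Longrightarrow> (\<psi>' \<bullet> \<psi>) \<diamondop> (\<phi>' \<bullet> \<phi>) = (\<psi>' \<diamondop> \<phi>') \<bullet> (\<psi> \<diamondop> \<phi>)"
    and hid1: "a \<in> cells0 B
      \<Longrightarrow> hid1 B a \<in> Obj V \<and> src0 B (hid1 B a) = a \<and> tgt0 B (hid1 B a) = a"
    and lam_hom: "f \<in> Obj V \<Longrightarrow> in_hom V (blam B f) (hid1 B (tgt0 B f) \<star> f) f"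
    and lam_iso: "f \<in> Obj V \<Longrightarrow> iso_arr V (blam B f)"
    and lam_natural: "\<phi> \<in> Arr V
      \<Longrightarrow> \<phi> \<bullet> blam B (Dom V \<phi>)
        = blam B (Cod V \<phi>) \<bullet> (I (hid1 B (tgt0 B (Dom V \<phi>))) \<diamondop> \<phi>)"
    and rho_hom: "f \<in> Obj V \<Longrightarrow> in_hom V (brho B f) (f \<star> hid1 B (src0 B f)) f"
    and rho_iso: "f \<in> Obj V \<Longrightarrow> iso_arr V (brho B f)"
    and rho_natural: "\<phi> \<in> Arr V
      \<Longrightarrow> \<phi> \<bullet> brho B (Dom V \<phi>)
        = brho B (Cod V \<phi>) \<bullet> (\<phi> \<diamondop> I (hid1 B (src0 B (Dom V \<phi>))))"
    and assoc_hom: "f \<in> Obj V \<Longrightarrow> g \<in> Obj V \<Longrightarrow> h \<in> Obj V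
      \<Longrightarrow> tgt0 B h = src0 B g \<Longrightarrow> tgt0 B g = src0 B f
      \<Longrightarrow> in_hom V (bassoc B f g h) (f \<star> (g \<star> h)) ((f \<star> g) \<star> h)"
    and assoc_iso: "f \<in> Obj V \<Longrightarrow> g \<in> Obj V \<Longrightarrow> h \<in> Obj V
      \<Longrightarrow> tgt0 B h = src0 B g \<Longrightarrow> tgt0 B g = src0 B f
      \<Longrightarrow> iso_arr V (bassoc B f g h)"
    and assoc_natural: "\<phi> \<in> Arr V \<Longrightarrow> \<psi> \<in> Arr V \<Longrightarrow> \<theta> \<in> Arr V
      \<Longrightarrow> tgt0 B (Dom V \<phi>) = src0 B (Dom V \<psi>) \<Longrightarrow> tgt0 B (Dom V \<psi>) = src0 B (Dom V \<theta>)
      \<Longrightarrow> bassoc B (Cod V \<theta>) (Cod V \<psi>) (Cod V \<phi>) \<bullet> (\<theta> \<diamondop> (\<psi> \<diamondop> \<phi>))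
        = ((\<theta> \<diamondop> \<psi>) \<diamondop> \<phi>) \<bullet> bassoc B (Dom V \<theta>) (Dom V \<psi>) (Dom V \<phi>)"
    and triangle: "f \<in> Obj V \<Longrightarrow> g \<in> Obj V \<Longrightarrow> tgt0 B g = src0 B f
      \<Longrightarrow> (brho B f \<diamondop> I g) \<bullet> bassoc B f (hid1 B (src0 B f)) g = I f \<diamondop> blam B g"
    and pentagon: "f \<in> Obj V \<Longrightarrow> g \<in> Obj V \<Longrightarrow> h \<in> Obj V \<Longrightarrow> k \<in> Obj V
      \<Longrightarrow> tgt0 B k = src0 B h \<Longrightarrow> tgt0 B h = src0 B g \<Longrightarrow> tgt0 B g = src0 B f
      \<Longrightarrow> bassoc B (f \<star> g) h k \<bullet> bassoc B f g (h \<star> k)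
        = (bassoc B f g h \<diamondop> I k) \<bullet> bassoc B f (g \<star> h) k \<bullet> (I f \<diamondop> bassoc B g h k)"

record ('o, 'h, 'c, 'v) deco_bicat =
  underlying :: "('o, 'h, 'c) bicat"
  decoration :: "('o, 'v) cat"

locale decorated_bicategory =
  fixes D :: "('o, 'h, 'c, 'v) deco_bicat"
  assumes underlying_bicategory: "bicategory (underlying D)"
    and decoration_category: "category (decoration D)"
    and Obj_decoration: "Obj (decoration D) = cells0 (underlying D)"

section \<open>Pseudo double categories\<close>

record ('o, 'v, 'h, 's) dblcat =
  C0 :: "('o, 'v) cat"
  C1 :: "('h, 's) cat"
  srcF :: "('h, 's, 'o, 'v) ftor"
  tgtF :: "('h, 's, 'o, 'v) ftor"
  hidF :: "('o, 'v, 'h, 's) ftor"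
  hcompF :: "('h \<times> 'h, 's \<times> 's, 'h, 's) ftor"
  dlam :: "'h \<Rightarrow> 's"
  drho :: "'h \<Rightarrow> 's"
  dassoc :: "'h \<Rightarrow> 'h \<Rightarrow> 'h \<Rightarrow> 's"

text \<open>A pair \<open>(\<Phi>, \<Psi>)\<close> in the pullback is sent by \<open>hcompF\<close> to \<open>\<Psi> * \<Phi>\<close>; the next two
  constants restore the applicative order.\<close>

definition hcomp_obj :: "('o, 'v, 'h, 's) dblcat \<Rightarrow> 'h \<Rightarrow> 'h \<Rightarrow> 'h" where
  "hcomp_obj C g f = on_obj (hcompF C) (f, g)"

definition hcomp_arr :: "('o, 'v, 'h, 's) dblcat \<Rightarrow> 's \<Rightarrow> 's \<Rightarrow> 's" where
  "hcomp_arr C \<psi> \<phi> = on_arr (hcompF C) (\<phi>, \<psi>)"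

definition globular :: "('o, 'v, 'h, 's) dblcat \<Rightarrow> 's \<Rightarrow> bool" where
  "globular C \<phi> \<longleftrightarrow> \<phi> \<in> Arr (C1 C) \<and>
     (\<exists>a \<in> Obj (C0 C). on_arr (srcF C) \<phi> = Ident (C0 C) a) \<and>
     (\<exists>b \<in> Obj (C0 C). on_arr (tgtF C) \<phi> = Ident (C0 C) b)"

locale double_category =
  fixes C :: "('o, 'v, 'h, 's) dblcat"
  fixes V and hc1 (infixr "\<star>" 75) and hc2 (infixr "\<diamondop>" 75) and vc (infixl "\<bullet>" 70) and I
    and s0 and t0 and s1 and t1 and i0 and i1
  defines "V \<equiv> C1 C" and "hc1 \<equiv> hcomp_obj C" and "hc2 \<equiv> hcomp_arr C"
    and "vc \<equiv> Comp (C1 C)" and "I \<equiv> Ident (C1 C)"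
    and "s0 \<equiv> on_obj (srcF C)" and "t0 \<equiv> on_obj (tgtF C)"
    and "s1 \<equiv> on_arr (srcF C)" and "t1 \<equiv> on_arr (tgtF C)"
    and "i0 \<equiv> on_obj (hidF C)" and "i1 \<equiv> on_arr (hidF C)"
  assumes srcF: "is_functor V (C0 C) (srcF C)"
    and tgtF: "is_functor V (C0 C) (tgtF C)"
    and hidF: "is_functor (C0 C) V (hidF C)"
    and hcompF: "is_functor (pullback_cat V V (tgtF C) (srcF C)) V (hcompF C)"
    and src_hid_obj: "a \<in> Obj (C0 C) \<Longrightarrow> s0 (i0 a) = a"
    and tgt_hid_obj: "a \<in> Obj (C0 C) \<Longrightarrow> t0 (i0 a) = a"
    and src_hid_arr: "u \<in> Arr (C0 C) \<Longrightarrow> s1 (i1 u) = u"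
    and tgt_hid_arr: "u \<in> Arr (C0 C) \<Longrightarrow> t1 (i1 u) = u"
    and src_hcomp_obj: "f \<in> Obj V \<Longrightarrow> g \<in> Obj V \<Longrightarrow> t0 f = s0 g \<Longrightarrow> s0 (g \<star> f) = s0 f"
    and tgt_hcomp_obj: "f \<in> Obj V \<Longrightarrow> g \<in> Obj V \<Longrightarrow> t0 f = s0 g \<Longrightarrow> t0 (g \<star> f) = t0 g"
    and src_hcomp_arr: "\<phi> \<in> Arr V \<Longrightarrow> \<psi> \<in> Arr V \<Longrightarrow> t1 \<phi> = s1 \<psi> \<Longrightarrow> s1 (\<psi> \<diamondop> \<phi>) = s1 \<phi>"
    and tgt_hcomp_arr: "\<phi> \<in> Arr V \<Longrightarrow> \<psi> \<in> Arr V \<Longrightarrow> t1 \<phi> = s1 \<psi> \<Longrightarrow> t1 (\<psi> \<diamondop> \<phi>) = t1 \<psi>"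
    and lam_hom: "f \<in> Obj V \<Longrightarrow> in_hom V (dlam C f) (i0 (t0 f) \<star> f) f"
    and lam_iso: "f \<in> Obj V \<Longrightarrow> iso_arr V (dlam C f)"
    and lam_globular: "f \<in> Obj V \<Longrightarrow> globular C (dlam C f)"
    and lam_natural: "\<phi> \<in> Arr V
      \<Longrightarrow> \<phi> \<bullet> dlam C (Dom V \<phi>) = dlam C (Cod V \<phi>) \<bullet> (i1 (t1 \<phi>) \<diamondop> \<phi>)"
    and rho_hom: "f \<in> Obj V \<Longrightarrow> in_hom V (drho C f) (f \<star> i0 (s0 f)) f"
    and rho_iso: "f \<in> Obj V \<Longrightarrow> iso_arr V (drho C f)"
    and rho_globular: "f \<in> Obj V \<Longrightarrow> globular C (drho C f)"
    and rho_natural: "\<phi> \<in> Arr V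
      \<Longrightarrow> \<phi> \<bullet> drho C (Dom V \<phi>) = drho C (Cod V \<phi>) \<bullet> (\<phi> \<diamondop> i1 (s1 \<phi>))"
    and assoc_hom: "f \<in> Obj V \<Longrightarrow> g \<in> Obj V \<Longrightarrow> h \<in> Obj V \<Longrightarrow> t0 h = s0 g \<Longrightarrow> t0 g = s0 f
      \<Longrightarrow> in_hom V (dassoc C f g h) (f \<star> (g \<star> h)) ((f \<star> g) \<star> h)"
    and assoc_iso: "f \<in> Obj V \<Longrightarrow> g \<in> Obj V \<Longrightarrow> h \<in> Obj V \<Longrightarrow> t0 h = s0 g \<Longrightarrow> t0 g = s0 f
      \<Longrightarrow> iso_arr V (dassoc C f g h)"
    and assoc_globular: "f \<in> Obj V \<Longrightarrow> g \<in> Obj V \<Longrightarrow> h \<in> Obj V \<Longrightarrow> t0 h = s0 g \<Longrightarrow> t0 g = s0 f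
      \<Longrightarrow> globular C (dassoc C f g h)"
    and assoc_natural: "\<phi> \<in> Arr V \<Longrightarrow> \<psi> \<in> Arr V \<Longrightarrow> \<theta> \<in> Arr V \<Longrightarrow> t1 \<phi> = s1 \<psi> \<Longrightarrow> t1 \<psi> = s1 \<theta>
      \<Longrightarrow> dassoc C (Cod V \<theta>) (Cod V \<psi>) (Cod V \<phi>) \<bullet> (\<theta> \<diamondop> (\<psi> \<diamondop> \<phi>))
        = ((\<theta> \<diamondop> \<psi>) \<diamondop> \<phi>) \<bullet> dassoc C (Dom V \<theta>) (Dom V \<psi>) (Dom V \<phi>)"
    and triangle: "f \<in> Obj V \<Longrightarrow> g \<in> Obj V \<Longrightarrow> t0 g = s0 f
      \<Longrightarrow> (drho C f \<diamondop> I g) \<bullet> dassoc C f (i0 (s0 f)) g = I f \<diamondop> dlam C g"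
    and pentagon: "f \<in> Obj V \<Longrightarrow> g \<in> Obj V \<Longrightarrow> h \<in> Obj V \<Longrightarrow> k \<in> Obj V
      \<Longrightarrow> t0 k = s0 h \<Longrightarrow> t0 h = s0 g \<Longrightarrow> t0 g = s0 f
      \<Longrightarrow> dassoc C (f \<star> g) h k \<bullet> dassoc C f g (h \<star> k)
        = (dassoc C f g h \<diamondop> I k) \<bullet> dassoc C f (g \<star> h) k \<bullet> (I f \<diamondop> dassoc C g h k)"

definition horizontal_bicat :: "('o, 'v, 'h, 's) dblcat \<Rightarrow> ('o, 'h, 's) bicat" where
  "horizontal_bicat C =
    \<lparr>cells0 = Obj (C0 C),
     cells = (C1 C)\<lparr>Arr := {\<phi> \<in> Arr (C1 C). globular C \<phi>}\<rparr>,
     src0 = on_obj (srcF C),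
     tgt0 = on_obj (tgtF C),
     hcomp1 = hcomp_obj C,
     hcomp2 = hcomp_arr C,
     hid1 = on_obj (hidF C),
     blam = dlam C,
     brho = drho C,
     bassoc = dassoc C\<rparr>"

definition decorated_horizontalization ::
  "('o, 'v, 'h, 's) dblcat \<Rightarrow> ('o, 'h, 's, 'v) deco_bicat" where
  "decorated_horizontalization C = \<lparr>underlying = horizontal_bicat C, decoration = C0 C\<rparr>"

text \<open>Equality of structures: equal carriers, and operations that agree on the carriers. HOL
  equality of the records would also compare the meaningless values outside the carriers.\<close>

definition same_cat :: "('o, 'a) cat \<Rightarrow> ('o, 'a) cat \<Rightarrow> bool" where
  "same_cat C D \<longleftrightarrow> Obj C = Obj D \<and> Arr C = Arr D \<and>
     (\<forall>f \<in> Arr C. Dom C f = Dom D f \<and> Cod C f = Cod D f) \<and>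
     (\<forall>a \<in> Obj C. Ident C a = Ident D a) \<and>
     (\<forall>f \<in> Arr C. \<forall>g \<in> Arr C. Cod C f = Dom C g \<longrightarrow> Comp C g f = Comp D g f)"

definition same_bicat :: "('o, 'h, 'c) bicat \<Rightarrow> ('o, 'h, 'c) bicat \<Rightarrow> bool" where
  "same_bicat B B' \<longleftrightarrow> cells0 B = cells0 B' \<and> same_cat (cells B) (cells B') \<and>
     (\<forall>f \<in> Obj (cells B). src0 B f = src0 B' f \<and> tgt0 B f = tgt0 B' f \<and>
        blam B f = blam B' f \<and> brho B f = brho B' f) \<and>
     (\<forall>a \<in> cells0 B. hid1 B a = hid1 B' a) \<and>
     (\<forall>f \<in> Obj (cells B). \<forall>g \<in> Obj (cells B). tgt0 B f = src0 B g
        \<longrightarrow> hcomp1 B g f = hcomp1 B' g f) \<and>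
     (\<forall>\<phi> \<in> Arr (cells B). \<forall>\<psi> \<in> Arr (cells B).
        tgt0 B (Dom (cells B) \<phi>) = src0 B (Dom (cells B) \<psi>)
        \<longrightarrow> hcomp2 B \<psi> \<phi> = hcomp2 B' \<psi> \<phi>) \<and>
     (\<forall>f \<in> Obj (cells B). \<forall>g \<in> Obj (cells B). \<forall>h \<in> Obj (cells B).
        tgt0 B h = src0 B g \<longrightarrow> tgt0 B g = src0 B f \<longrightarrow> bassoc B f g h = bassoc B' f g h)"

definition same_deco_bicat ::
  "('o, 'h, 'c, 'v) deco_bicat \<Rightarrow> ('o, 'h, 'c, 'v) deco_bicat \<Rightarrow> bool" where
  "same_deco_bicat D D' \<longleftrightarrow> same_bicat (underlying D) (underlying D') \<and>
     same_cat (decoration D) (decoration D')"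

definition internalization ::
  "('o, 'v, 'h, 's) dblcat \<Rightarrow> ('o, 'h, 's, 'v) deco_bicat \<Rightarrow> bool" where
  "internalization C D \<longleftrightarrow> decorated_bicategory D \<and> double_category C \<and>
     same_deco_bicat (decorated_horizontalization C) D"

section \<open>The free globularily generated double category\<close>

text \<open>Formal expressions. \<open>Cell2 \<phi>\<close> is the 2-cell \<open>\<phi>\<close>, \<open>HId f\<close> the symbol \<open>i\<^sub>f\<close>,
  \<open>Word y x\<close> the concatenation of parenthesized words with \<open>x\<close> applied first, and
  \<open>Path \<alpha> [x\<^sub>1, \<dots>, x\<^sub>n]\<close> the path \<open>x\<^sub>n \<circ> \<dots> \<circ> x\<^sub>1\<close> starting at the 1-cell \<open>\<alpha>\<close>.

  The identifications of a path of length one with its entry, of a word of length one with its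
  letter, and of composites differing only through these are built in by only using normal forms:
  words of length one have no constructor, \<open>Path\<close> is only used for paths of length different from
  one, and the entries of a \<open>Path\<close> are never themselves \<open>Path\<close>s.\<close>

datatype ('h, 'c, 'v) expr =
    Cell2 'c
  | HId 'v
  | Word "('h, 'c, 'v) expr" "('h, 'c, 'v) expr"
  | Path 'h "('h, 'c, 'v) expr list"

context
  fixes B :: "('o, 'h, 'c, 'v) deco_bicat"
begin

primrec d_inf :: "('h, 'c, 'v) expr \<Rightarrow> 'h" where
  "d_inf (Cell2 \<phi>) = Dom (cells (underlying B)) \<phi>"
| "d_inf (HId f) = hid1 (underlying B) (Dom (decoration B) f)"
| "d_inf (Word y x) = hcomp1 (underlying B) (d_inf y) (d_inf x)"
| "d_inf (Path \<alpha> xs) = \<alpha>"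

primrec c_inf :: "('h, 'c, 'v) expr \<Rightarrow> 'h" where
  "c_inf (Cell2 \<phi>) = Cod (cells (underlying B)) \<phi>"
| "c_inf (HId f) = hid1 (underlying B) (Cod (decoration B) f)"
| "c_inf (Word y x) = hcomp1 (underlying B) (c_inf y) (c_inf x)"
| "c_inf (Path \<alpha> xs) = last (\<alpha> # map c_inf xs)"

primrec s_inf :: "('h, 'c, 'v) expr \<Rightarrow> 'v" where
  "s_inf (Cell2 \<phi>) = Ident (decoration B) (src0 (underlying B) (Dom (cells (underlying B)) \<phi>))"
| "s_inf (HId f) = f"
| "s_inf (Word y x) = s_inf x"
| "s_inf (Path \<alpha> xs) = foldl (\<lambda>u v. Comp (decoration B) v u)
     (Ident (decoration B) (src0 (underlying B) \<alpha>)) (map s_inf xs)"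

primrec t_inf :: "('h, 'c, 'v) expr \<Rightarrow> 'v" where
  "t_inf (Cell2 \<phi>) = Ident (decoration B) (tgt0 (underlying B) (Dom (cells (underlying B)) \<phi>))"
| "t_inf (HId f) = f"
| "t_inf (Word y x) = t_inf y"
| "t_inf (Path \<alpha> xs) = foldl (\<lambda>u v. Comp (decoration B) v u)
     (Ident (decoration B) (tgt0 (underlying B) \<alpha>)) (map t_inf xs)"

primrec entries :: "('h, 'c, 'v) expr \<Rightarrow> ('h, 'c, 'v) expr list" where
  "entries (Cell2 \<phi>) = [Cell2 \<phi>]"
| "entries (HId f) = [HId f]"
| "entries (Word y x) = [Word y x]"
| "entries (Path \<alpha> xs) = xs"

definition mk_path :: "'h \<Rightarrow> ('h, 'c, 'v) expr list \<Rightarrow> ('h, 'c, 'v) expr" where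
  "mk_path \<alpha> xs = (case xs of [x] \<Rightarrow> x | _ \<Rightarrow> Path \<alpha> xs)"

text \<open>Concatenation of paths, in normal form.\<close>

definition vcomp :: "('h, 'c, 'v) expr \<Rightarrow> ('h, 'c, 'v) expr \<Rightarrow> ('h, 'c, 'v) expr"
  (infixl "\<bullet>\<^sub>\<infinity>" 70) where
  "y \<bullet>\<^sub>\<infinity> x = mk_path (d_inf x) (entries x @ entries y)"

abbreviation hconc :: "('h, 'c, 'v) expr \<Rightarrow> ('h, 'c, 'v) expr \<Rightarrow> ('h, 'c, 'v) expr"
  (infixr "\<star>\<^sub>\<infinity>" 75) where
  "y \<star>\<^sub>\<infinity> x \<equiv> Word y x"

definition generators :: "('h, 'c, 'v) expr set" where
  "generators = Cell2 ` Arr (cells (underlying B)) \<union> HId ` Arr (decoration B)"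

text \<open>Parenthesized words in \<open>X\<close>; by the definition of \<open>s\<close> and \<open>t\<close> on words, the side condition
  is the one on adjacent letters.\<close>

inductive_set words :: "('h, 'c, 'v) expr set \<Rightarrow> ('h, 'c, 'v) expr set"
  for X :: "('h, 'c, 'v) expr set" where
  letter: "x \<in> X \<Longrightarrow> x \<in> words X"
| concat: "x \<in> words X \<Longrightarrow> y \<in> words X \<Longrightarrow> t_inf x = s_inf y \<Longrightarrow> y \<star>\<^sub>\<infinity> x \<in> words X"

text \<open>Arrows of the path category generated by \<open>X\<close>.\<close>

inductive_set paths :: "('h, 'c, 'v) expr set \<Rightarrow> ('h, 'c, 'v) expr set"
  for X :: "('h, 'c, 'v) expr set" where
  empty: "\<alpha> \<in> Obj (cells (underlying B)) \<Longrightarrow> Path \<alpha> [] \<in> paths X"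
| step: "p \<in> paths X \<Longrightarrow> x \<in> X \<Longrightarrow> c_inf p = d_inf x \<Longrightarrow> x \<bullet>\<^sub>\<infinity> p \<in> paths X"

text \<open>\<open>E_level k\<close> is \<open>E\<close> with index \<open>k + 1\<close>, and \<open>paths (E_level k)\<close> is the set of arrows of
  \<open>F\<close> with index \<open>k + 1\<close>.\<close>

primrec E_level :: "nat \<Rightarrow> ('h, 'c, 'v) expr set" where
  "E_level 0 = words generators"
| "E_level (Suc k) = words (paths (E_level k))"

definition E_inf :: "('h, 'c, 'v) expr set" where
  "E_inf = (\<Union>k. E_level k)"

definition F_inf :: "('h, ('h, 'c, 'v) expr) cat" where
  "F_inf = \<lparr>Obj = Obj (cells (underlying B)), Arr = E_inf, Dom = d_inf, Cod = c_inf,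
     Ident = (\<lambda>\<alpha>. Path \<alpha> []), Comp = vcomp\<rparr>"

inductive_set R_inf :: "(('h, 'c, 'v) expr \<times> ('h, 'c, 'v) expr) set" where
  refl: "x \<in> E_inf \<Longrightarrow> (x, x) \<in> R_inf"
| sym: "(x, y) \<in> R_inf \<Longrightarrow> (y, x) \<in> R_inf"
| trans: "(x, y) \<in> R_inf \<Longrightarrow> (y, z) \<in> R_inf \<Longrightarrow> (x, z) \<in> R_inf"
| vcomp_cong: "(x, x') \<in> R_inf \<Longrightarrow> (y, y') \<in> R_inf \<Longrightarrow> c_inf x = d_inf y \<Longrightarrow> c_inf x' = d_inf y'
    \<Longrightarrow> (y \<bullet>\<^sub>\<infinity> x, y' \<bullet>\<^sub>\<infinity> x') \<in> R_inf"
| hconc_cong: "(x, x') \<in> R_inf \<Longrightarrow> (y, y') \<in> R_inf \<Longrightarrow> t_inf x = s_inf y \<Longrightarrow> t_inf x' = s_inf y'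
    \<Longrightarrow> (y \<star>\<^sub>\<infinity> x, y' \<star>\<^sub>\<infinity> x') \<in> R_inf"
| interchange: "x\<^sub>1 \<in> E_inf \<Longrightarrow> x\<^sub>2 \<in> E_inf \<Longrightarrow> y\<^sub>1 \<in> E_inf \<Longrightarrow> y\<^sub>2 \<in> E_inf
    \<Longrightarrow> t_inf x\<^sub>1 = s_inf x\<^sub>2 \<Longrightarrow> t_inf y\<^sub>1 = s_inf y\<^sub>2
    \<Longrightarrow> c_inf x\<^sub>1 = d_inf y\<^sub>1 \<Longrightarrow> c_inf x\<^sub>2 = d_inf y\<^sub>2
    \<Longrightarrow> ((y\<^sub>2 \<star>\<^sub>\<infinity> y\<^sub>1) \<bullet>\<^sub>\<infinity> (x\<^sub>2 \<star>\<^sub>\<infinity> x\<^sub>1), (y\<^sub>2 \<bullet>\<^sub>\<infinity> x\<^sub>2) \<star>\<^sub>\<infinity> (y\<^sub>1 \<bullet>\<^sub>\<infinity> x\<^sub>1)) \<in> R_inf"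
| vcomp_cells: "\<phi> \<in> Arr (cells (underlying B)) \<Longrightarrow> \<psi> \<in> Arr (cells (underlying B))
    \<Longrightarrow> Cod (cells (underlying B)) \<phi> = Dom (cells (underlying B)) \<psi>
    \<Longrightarrow> (Cell2 \<psi> \<bullet>\<^sub>\<infinity> Cell2 \<phi>, Cell2 (Comp (cells (underlying B)) \<psi> \<phi>)) \<in> R_inf"
| vcomp_HId: "f \<in> Arr (decoration B) \<Longrightarrow> g \<in> Arr (decoration B)
    \<Longrightarrow> Cod (decoration B) f = Dom (decoration B) g
    \<Longrightarrow> (HId g \<bullet>\<^sub>\<infinity> HId f, HId (Comp (decoration B) g f)) \<in> R_inf"
| Ident_cells: "\<alpha> \<in> Obj (cells (underlying B))
    \<Longrightarrow> (Path \<alpha> [], Cell2 (Ident (cells (underlying B)) \<alpha>)) \<in> R_inf"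
| Ident_HId: "a \<in> cells0 (underlying B)
    \<Longrightarrow> (HId (Ident (decoration B) a),
         Cell2 (Ident (cells (underlying B)) (hid1 (underlying B) a))) \<in> R_inf"
| hconc_cells: "\<phi> \<in> Arr (cells (underlying B)) \<Longrightarrow> \<psi> \<in> Arr (cells (underlying B))
    \<Longrightarrow> tgt0 (underlying B) (Dom (cells (underlying B)) \<phi>)
        = src0 (underlying B) (Dom (cells (underlying B)) \<psi>)
    \<Longrightarrow> (Cell2 \<psi> \<star>\<^sub>\<infinity> Cell2 \<phi>, Cell2 (hcomp2 (underlying B) \<psi> \<phi>)) \<in> R_inf"
| lam: "x \<in> E_inf
    \<Longrightarrow> (x, Cell2 (blam (underlying B) (c_inf x)) \<bullet>\<^sub>\<infinity> (HId (t_inf x) \<star>\<^sub>\<infinity> x)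
           \<bullet>\<^sub>\<infinity> Cell2 (inv_arr (cells (underlying B)) (blam (underlying B) (d_inf x)))) \<in> R_inf"
| rho: "x \<in> E_inf
    \<Longrightarrow> (x, Cell2 (brho (underlying B) (c_inf x)) \<bullet>\<^sub>\<infinity> (x \<star>\<^sub>\<infinity> HId (s_inf x))
           \<bullet>\<^sub>\<infinity> Cell2 (inv_arr (cells (underlying B)) (brho (underlying B) (d_inf x)))) \<in> R_inf"
| assoc: "x \<in> E_inf \<Longrightarrow> y \<in> E_inf \<Longrightarrow> z \<in> E_inf \<Longrightarrow> t_inf x = s_inf y \<Longrightarrow> t_inf y = s_inf z
    \<Longrightarrow> (Cell2 (bassoc (underlying B) (c_inf z) (c_inf y) (c_inf x)) \<bullet>\<^sub>\<infinity> (z \<star>\<^sub>\<infinity> (y \<star>\<^sub>\<infinity> x)),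
         ((z \<star>\<^sub>\<infinity> y) \<star>\<^sub>\<infinity> x) \<bullet>\<^sub>\<infinity> Cell2 (bassoc (underlying B) (d_inf z) (d_inf y) (d_inf x)))
       \<in> R_inf"

definition V_inf :: "('h, ('h, 'c, 'v) expr set) cat" where
  "V_inf = quotient_cat F_inf R_inf"

definition free_double :: "('o, 'v, 'h, ('h, 'c, 'v) expr set) dblcat" where
  "free_double =
    \<lparr>C0 = decoration B,
     C1 = V_inf,
     srcF = \<lparr>on_obj = src0 (underlying B), on_arr = (\<lambda>X. s_inf (class_rep X))\<rparr>,
     tgtF = \<lparr>on_obj = tgt0 (underlying B), on_arr = (\<lambda>X. t_inf (class_rep X))\<rparr>,
     hidF = \<lparr>on_obj = hid1 (underlying B), on_arr = (\<lambda>f. R_inf `` {HId f})\<rparr>,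
     hcompF = \<lparr>on_obj = (\<lambda>(f, g). hcomp1 (underlying B) g f),
               on_arr = (\<lambda>(X, Y). R_inf `` {class_rep Y \<star>\<^sub>\<infinity> class_rep X})\<rparr>,
     dlam = (\<lambda>f. R_inf `` {Cell2 (blam (underlying B) f)}),
     drho = (\<lambda>f. R_inf `` {Cell2 (brho (underlying B) f)}),
     dassoc = (\<lambda>f g h. R_inf `` {Cell2 (bassoc (underlying B) f g h)})\<rparr>"

end

end

theory Submission
  imports Defs
begin

text \<open>Two things matter: the horizontalization of any double category is a bicategory, because
  globular squares are closed under all operations and under vertical inverses, and \<open>Q\<^sub>B\<close> is a
  double category. For the latter, normal forms make vertical composition of formal expressions
  strictly associative and unital, boundaries are invariant under \<open>R\<^sub>\<infinity>\<close>, and relations (1), (4)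
  and (5) are the functoriality of \<open>*\<close> and the naturality axioms; unitors and associators are 2-cells
  of \<open>B\<close>, so their inverses and the coherence laws come from \<open>B\<close> by (2) and (3).\<close>

section \<open>Pullbacks and quotients of categories\<close>

context category
begin

lemma Ident_simps [simp]:
  assumes "a \<in> Obj C"
  shows "Ident C a \<in> Arr C" "Dom C (Ident C a) = a" "Cod C (Ident C a) = a"
  using Ident_hom[OF assms] by (simp_all add: in_hom_def)

lemma Comp_simps [simp]:
  assumes "f \<in> Arr C" "g \<in> Arr C" "Cod C f = Dom C g"
  shows "g \<cdot> f \<in> Arr C" "Dom C (g \<cdot> f) = Dom C f" "Cod C (g \<cdot> f) = Cod C g"
  using Comp_hom[OF assms] by (simp_all add: in_hom_def)

declare Dom_Obj [simp] Cod_Obj [simp] Comp_Ident_left [simp] Comp_Ident_right [simp]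

lemma Ident_Ident: "a \<in> Obj C \<Longrightarrow> Ident C a \<cdot> Ident C a = Ident C a"
  using Comp_Ident_left[of "Ident C a"] by simp

lemma inverse_arrows_unique:
  assumes "inverse_arrows C f g" "inverse_arrows C f h"
  shows "g = h"
proof -
  have f: "f \<in> Arr C"
    and g: "g \<in> Arr C" "Dom C g = Cod C f" "Cod C g = Dom C f" "g \<cdot> f = Ident C (Dom C f)"
    and h: "h \<in> Arr C" "Dom C h = Cod C f" "Cod C h = Dom C f" "f \<cdot> h = Ident C (Cod C f)"
    using assms by (auto simp: inverse_arrows_def in_hom_def)
  have "(g \<cdot> f) \<cdot> h = g \<cdot> (f \<cdot> h)"
    by (rule Comp_assoc) (simp_all add: f g h)
  then show ?thesis
    using Comp_Ident_right[OF g(1)] Comp_Ident_left[OF h(1)] by (simp add: g h)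
qed

lemma inverse_arrows_inv_arr:
  assumes "iso_arr C f"
  shows "inverse_arrows C f (inv_arr C f)"
proof -
  obtain g where g: "inverse_arrows C f g"
    using assms by (auto simp: iso_arr_def)
  show ?thesis
    unfolding inv_arr_def using g by (rule theI) (rule inverse_arrows_unique[OF _ g])
qed

text \<open>The 2-cells of the horizontal bicategory are cut out of the category of squares in this
  way: all horizontal morphisms stay objects, only the globular squares stay arrows.\<close>

lemma category_restrict:
  assumes "A \<subseteq> Arr C"
    and "\<And>a. a \<in> Obj C \<Longrightarrow> Ident C a \<in> A"
    and "\<And>f g. f \<in> A \<Longrightarrow> g \<in> A \<Longrightarrow> Cod C f = Dom C g \<Longrightarrow> g \<cdot> f \<in> A"
  shows "category (C\<lparr>Arr := A\<rparr>)"
  by unfold_locales (use assms in \<open>auto simp: in_hom_def subset_iff Comp_assoc\<close>)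

end

lemma category_pullback_cat:
  assumes "is_functor C E F" "is_functor D E G"
  shows "category (pullback_cat C D F G)"
proof -
  interpret F: is_functor C E F by fact
  interpret G: is_functor D E G by fact
  \<comment> \<open>Functors that agree on a pair of arrows agree on its boundary objects, so
    \<open>Dom\<close> and \<open>Cod\<close> of a pair land in the pullback of objects.\<close>
  have cod: "on_obj F (Cod C f) = on_obj G (Cod D g) \<and> on_obj F (Dom C f) = on_obj G (Dom D g)"
    if "f \<in> Arr C" "g \<in> Arr D" "on_arr F f = on_arr G g" for f g
    using F.on_arr[OF that(1)] G.on_arr[OF that(2)] that(3) by (auto simp: in_hom_def)
  show ?thesis
    by unfold_locales
      (auto simp: pullback_cat_def in_hom_def cod F.on_Ident G.on_Ident F.on_Comp G.on_Comp
        F.C.Comp_assoc G.C.Comp_assoc)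
qed

section \<open>Quotients by a congruence on parallel arrows\<close>

lemma class_rep_in:
  assumes "X \<in> A // R" "equiv A R"
  shows "class_rep X \<in> X"
  unfolding class_rep_def using assms by (metis equiv_Eps_in)

lemma class_rep_related:
  assumes "equiv A R" "x \<in> A"
  shows "(x, class_rep (R `` {x})) \<in> R"
  using class_rep_in[OF quotientI[OF assms(2)] assms(1)] by simp

text \<open>In \<open>cong\<close> only the unprimed pair is asked to be composable;
  \<open>parallel\<close> transfers this to the primed pair.\<close>

locale category_congruence = category +
  fixes R :: "('a \<times> 'a) set"
  assumes equiv: "equiv (Arr C) R"
    and parallel: "(f, f') \<in> R \<Longrightarrow> Dom C f = Dom C f' \<and> Cod C f = Cod C f'"
    and cong: "(f, f') \<in> R \<Longrightarrow> (g, g') \<in> R \<Longrightarrow> Cod C f = Dom C g \<Longrightarrow> (g \<cdot> f, g' \<cdot> f') \<in> R"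
begin

abbreviation quot where "quot \<equiv> quotient_cat C R"

lemma quotient_Obj [simp]: "Obj quot = Obj C"
  and quotient_Ident [simp]: "Ident quot a = R `` {Ident C a}"
  by (simp_all add: quotient_cat_def)

lemma quotient_Arr_iff: "X \<in> Arr quot \<longleftrightarrow> (\<exists>f\<in>Arr C. X = R `` {f})"
  by (auto simp: quotient_cat_def quotient_def)

lemma quotient_Arr [simp]: "f \<in> Arr C \<Longrightarrow> R `` {f} \<in> Arr quot"
  by (auto simp: quotient_Arr_iff)

lemma class_eqI: "(f, g) \<in> R \<Longrightarrow> R `` {f} = R `` {g}"
  by (rule equiv_class_eq[OF equiv])

lemma class_rep_rel: "f \<in> Arr C \<Longrightarrow> (f, class_rep (R `` {f})) \<in> R"
  by (rule class_rep_related[OF equiv])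

lemma quotient_Dom [simp]: "f \<in> Arr C \<Longrightarrow> Dom quot (R `` {f}) = Dom C f"
  and quotient_Cod [simp]: "f \<in> Arr C \<Longrightarrow> Cod quot (R `` {f}) = Cod C f"
  using parallel[OF class_rep_rel] by (simp_all add: quotient_cat_def)

text \<open>The quotient composes chosen representatives; \<open>cong\<close> makes the result
  independent of the choice, so any representatives may be used from here on.\<close>

lemma quotient_Comp [simp]:
  assumes "f \<in> Arr C" "g \<in> Arr C" "Cod C f = Dom C g"
  shows "Comp quot (R `` {g}) (R `` {f}) = R `` {g \<cdot> f}"
proof -
  have "(g \<cdot> f, class_rep (R `` {g}) \<cdot> class_rep (R `` {f})) \<in> R"
    by (intro cong class_rep_rel assms)
  then show ?thesis
    by (simp add: quotient_cat_def class_eqI)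
qed

lemma category_quotient: "category quot"
  by unfold_locales (auto simp: quotient_Arr_iff in_hom_def Comp_assoc)

end

section \<open>The decorated horizontalization of a double category\<close>

context
  fixes C :: "('o, 'v, 'h, 's) dblcat"
  assumes dbl: "double_category C"
begin

interpretation D: double_category C "C1 C" "hcomp_obj C" "hcomp_arr C" "Comp (C1 C)" "Ident (C1 C)"
  "on_obj (srcF C)" "on_obj (tgtF C)" "on_arr (srcF C)" "on_arr (tgtF C)" "on_obj (hidF C)"
  "on_arr (hidF C)"
  by (rule dbl) (rule reflexive)+
interpretation S: is_functor "C1 C" "C0 C" "srcF C" by (rule D.srcF)
interpretation T: is_functor "C1 C" "C0 C" "tgtF C" by (rule D.tgtF)
interpretation I: is_functor "C0 C" "C1 C" "hidF C" by (rule D.hidF)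
interpretation P: is_functor "pullback_cat (C1 C) (C1 C) (tgtF C) (srcF C)" "C1 C" "hcompF C"
  by (rule D.hcompF)

lemma hcomp_obj:
  assumes "f \<in> Obj (C1 C)" "g \<in> Obj (C1 C)" "on_obj (tgtF C) f = on_obj (srcF C) g"
  shows "hcomp_obj C g f \<in> Obj (C1 C)"
  using P.on_obj[of "(f, g)"] assms by (simp add: pullback_cat_def hcomp_obj_def)

lemma hcomp_arr:
  assumes "\<phi> \<in> Arr (C1 C)" "\<psi> \<in> Arr (C1 C)" "on_arr (tgtF C) \<phi> = on_arr (srcF C) \<psi>"
  shows "in_hom (C1 C) (hcomp_arr C \<psi> \<phi>)
    (hcomp_obj C (Dom (C1 C) \<psi>) (Dom (C1 C) \<phi>)) (hcomp_obj C (Cod (C1 C) \<psi>) (Cod (C1 C) \<phi>))"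
  using P.on_arr[of "(\<phi>, \<psi>)"] assms by (simp add: pullback_cat_def hcomp_arr_def hcomp_obj_def)

lemma hcomp_Ident:
  assumes "f \<in> Obj (C1 C)" "g \<in> Obj (C1 C)" "on_obj (tgtF C) f = on_obj (srcF C) g"
  shows "hcomp_arr C (Ident (C1 C) g) (Ident (C1 C) f) = Ident (C1 C) (hcomp_obj C g f)"
  using P.on_Ident[of "(f, g)"] assms by (simp add: pullback_cat_def hcomp_arr_def hcomp_obj_def)

lemma hcomp_Comp:
  assumes "\<phi> \<in> Arr (C1 C)" "\<psi> \<in> Arr (C1 C)" "on_arr (tgtF C) \<phi> = on_arr (srcF C) \<psi>"
    and "\<phi>' \<in> Arr (C1 C)" "\<psi>' \<in> Arr (C1 C)" "on_arr (tgtF C) \<phi>' = on_arr (srcF C) \<psi>'"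
    and "Cod (C1 C) \<phi> = Dom (C1 C) \<phi>'" "Cod (C1 C) \<psi> = Dom (C1 C) \<psi>'"
  shows "hcomp_arr C (Comp (C1 C) \<psi>' \<psi>) (Comp (C1 C) \<phi>' \<phi>)
    = Comp (C1 C) (hcomp_arr C \<psi>' \<phi>') (hcomp_arr C \<psi> \<phi>)"
  using P.on_Comp[of "(\<phi>, \<psi>)" "(\<phi>', \<psi>')"] assms by (simp add: pullback_cat_def hcomp_arr_def)

lemma src_arr [simp]:
  assumes "\<phi> \<in> Arr (C1 C)"
  shows "on_arr (srcF C) \<phi> \<in> Arr (C0 C)"
    "Dom (C0 C) (on_arr (srcF C) \<phi>) = on_obj (srcF C) (Dom (C1 C) \<phi>)"
    "Cod (C0 C) (on_arr (srcF C) \<phi>) = on_obj (srcF C) (Cod (C1 C) \<phi>)"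
  using S.on_arr[OF assms] by (simp_all add: in_hom_def)

lemma tgt_arr [simp]:
  assumes "\<phi> \<in> Arr (C1 C)"
  shows "on_arr (tgtF C) \<phi> \<in> Arr (C0 C)"
    "Dom (C0 C) (on_arr (tgtF C) \<phi>) = on_obj (tgtF C) (Dom (C1 C) \<phi>)"
    "Cod (C0 C) (on_arr (tgtF C) \<phi>) = on_obj (tgtF C) (Cod (C1 C) \<phi>)"
  using T.on_arr[OF assms] by (simp_all add: in_hom_def)

section \<open>Globular squares and their closure properties\<close>

text \<open>\<open>globular\<close> only asserts that some objects carry the identities. Source and
  target preserve domains, which forces these objects to be the endpoints of the domain.\<close>

lemma globular_iff:
  "globular C \<phi> \<longleftrightarrow> \<phi> \<in> Arr (C1 C)
    \<and> on_arr (srcF C) \<phi> = Ident (C0 C) (on_obj (srcF C) (Dom (C1 C) \<phi>))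
    \<and> on_arr (tgtF C) \<phi> = Ident (C0 C) (on_obj (tgtF C) (Dom (C1 C) \<phi>))"
  using src_arr(2) tgt_arr(2) S.on_obj T.on_obj
  unfolding globular_def by (metis S.D.Ident_simps(2) S.C.Dom_Obj)

text \<open>The source of \<phi> is a vertical arrow from the source of its domain to the source of
  its codomain; being an identity, it has equal ends. The same holds for the target.\<close>

lemma globular_Cod:
  assumes "globular C \<phi>"
  shows "on_obj (srcF C) (Cod (C1 C) \<phi>) = on_obj (srcF C) (Dom (C1 C) \<phi>)"
    "on_obj (tgtF C) (Cod (C1 C) \<phi>) = on_obj (tgtF C) (Dom (C1 C) \<phi>)"
  using assms src_arr(3) tgt_arr(3) S.on_obj T.on_obj
  unfolding globular_iff by (metis S.D.Ident_simps(3) S.C.Dom_Obj)+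

lemma globular_Ident: "f \<in> Obj (C1 C) \<Longrightarrow> globular C (Ident (C1 C) f)"
  by (simp add: globular_iff S.on_Ident T.on_Ident)

lemma globular_Comp:
  assumes "globular C \<phi>" "globular C \<psi>" "Cod (C1 C) \<phi> = Dom (C1 C) \<psi>"
  shows "globular C (Comp (C1 C) \<psi> \<phi>)"
proof -
  have obj: "on_obj (srcF C) (Dom (C1 C) \<phi>) \<in> Obj (C0 C)" "on_obj (tgtF C) (Dom (C1 C) \<phi>) \<in> Obj (C0 C)"
    using assms(1) S.on_obj T.on_obj by (simp_all add: globular_iff)
  show ?thesis
    using assms globular_Cod[OF assms(1)] S.D.Comp_Ident_left[OF S.D.Ident_simps(1)[OF obj(1)]]
      S.D.Comp_Ident_left[OF S.D.Ident_simps(1)[OF obj(2)]] obj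
    by (simp add: globular_iff S.on_Comp T.on_Comp)
qed

text \<open>Applying source and target to \<psi> \<phi> = id, where \<phi> is sent to identities,
  leaves identities as the images of \<psi>. Hence invertible constraint squares stay invertible
  among globular squares.\<close>

lemma globular_inverse:
  assumes "inverse_arrows (C1 C) \<phi> \<psi>" "globular C \<phi>"
  shows "globular C \<psi>"
proof -
  have \<phi>: "\<phi> \<in> Arr (C1 C)" and \<psi>: "\<psi> \<in> Arr (C1 C)" "Dom (C1 C) \<psi> = Cod (C1 C) \<phi>"
    "Cod (C1 C) \<psi> = Dom (C1 C) \<phi>" and eq: "Comp (C1 C) \<psi> \<phi> = Ident (C1 C) (Dom (C1 C) \<phi>)"
    using assms(1) by (auto simp: inverse_arrows_def in_hom_def)
  show ?thesis
    using S.on_Comp[OF \<phi> \<psi>(1)] T.on_Comp[OF \<phi> \<psi>(1)] \<phi> \<psi> eq assms(2)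
      S.D.Comp_Ident_right[OF src_arr(1)[OF \<psi>(1)]] S.D.Comp_Ident_right[OF tgt_arr(1)[OF \<psi>(1)]]
      globular_Cod[OF assms(2)]
    by (simp add: globular_iff S.on_Ident T.on_Ident)
qed

lemma globular_iso:
  assumes "iso_arr (C1 C) \<phi>" "globular C \<phi>"
  shows "iso_arr ((C1 C)\<lparr>Arr := {\<phi> \<in> Arr (C1 C). globular C \<phi>}\<rparr>) \<phi>"
proof -
  obtain \<psi> where \<psi>: "inverse_arrows (C1 C) \<phi> \<psi>"
    using assms(1) by (auto simp: iso_arr_def)
  have "inverse_arrows ((C1 C)\<lparr>Arr := {\<phi> \<in> Arr (C1 C). globular C \<phi>}\<rparr>) \<phi> \<psi>"
    using \<psi> assms(2) globular_inverse[OF \<psi> assms(2)] by (auto simp: inverse_arrows_def in_hom_def)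
  then show ?thesis by (auto simp: iso_arr_def)
qed

text \<open>Horizontal composability is a condition on 0-cells in a bicategory and on vertical
  arrows in a double category; for globular squares the arrows are identities, so the first gives
  the second.\<close>

lemma globular_composable:
  assumes "globular C \<phi>" "globular C \<psi>"
    and "on_obj (tgtF C) (Dom (C1 C) \<phi>) = on_obj (srcF C) (Dom (C1 C) \<psi>)"
  shows "on_arr (tgtF C) \<phi> = on_arr (srcF C) \<psi>"
  using assms by (simp add: globular_iff)

lemma globular_hcomp:
  assumes "globular C \<phi>" "globular C \<psi>"
    and "on_obj (tgtF C) (Dom (C1 C) \<phi>) = on_obj (srcF C) (Dom (C1 C) \<psi>)"
  shows "globular C (hcomp_arr C \<psi> \<phi>)"
  using hcomp_arr[of \<phi> \<psi>] D.src_hcomp_arr[of \<phi> \<psi>] D.tgt_hcomp_arr[of \<phi> \<psi>]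
    D.src_hcomp_obj[of "Dom (C1 C) \<phi>" "Dom (C1 C) \<psi>"]
    D.tgt_hcomp_obj[of "Dom (C1 C) \<phi>" "Dom (C1 C) \<psi>"] globular_composable[OF assms] assms
  by (simp add: globular_iff in_hom_def)

text \<open>Turns the factor i(t \<phi>) in the naturality of the left unitor of a double category
  into the identity 2-cell that the bicategory axiom has there.\<close>

lemma hid_tgt_globular:
  assumes "globular C \<phi>"
  shows "on_arr (hidF C) (on_arr (tgtF C) \<phi>)
    = Ident (C1 C) (on_obj (hidF C) (on_obj (tgtF C) (Dom (C1 C) \<phi>)))"
  using assms T.on_obj by (simp add: globular_iff I.on_Ident)

lemma hid_src_globular:
  assumes "globular C \<phi>"
  shows "on_arr (hidF C) (on_arr (srcF C) \<phi>)
    = Ident (C1 C) (on_obj (hidF C) (on_obj (srcF C) (Dom (C1 C) \<phi>)))"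
  using assms S.on_obj by (simp add: globular_iff I.on_Ident)

section \<open>The horizontal bicategory\<close>

lemma bicategory_horizontal_bicat: "bicategory (horizontal_bicat C)"
\<comment> \<open>Goals follow the order of the axioms: 1 is the category of cells, 6 and 7 the
  boundaries of horizontal composites, 9 interchange, 13, 16 and 19 naturality, 20 and 21 triangle
  and pentagon.\<close>
proof (intro bicategory.intro, goal_cases)
  case 1
  show ?case
    unfolding horizontal_bicat_def
    by simp (rule S.C.category_restrict, auto intro: globular_Ident globular_Comp)
next
  case 6
  then show ?case
    by (simp add: horizontal_bicat_def hcomp_obj D.src_hcomp_obj D.tgt_hcomp_obj)
next
  case 7
  then show ?case
    using hcomp_arr globular_composable globular_hcomp by (simp add: horizontal_bicat_def in_hom_def)
next
  case (9 \<phi> \<phi>' \<psi> \<psi>')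
  then show ?case
    using globular_composable[of \<phi> \<psi>] globular_composable[of \<phi>' \<psi>'] globular_Cod[of \<phi>]
      globular_Cod[of \<psi>]
    by (simp add: horizontal_bicat_def hcomp_Comp)
next
  case 13
  then show ?case
    by (simp add: horizontal_bicat_def D.lam_natural hid_tgt_globular)
next
  case 16
  then show ?case
    by (simp add: horizontal_bicat_def D.rho_natural hid_src_globular)
next
  case 19
  then show ?case
    by (simp add: horizontal_bicat_def D.assoc_natural globular_composable)
next
  case 20
  then show ?case
    using D.triangle by (simp add: horizontal_bicat_def)
next
  case 21
  then show ?case
    using D.pentagon by (simp add: horizontal_bicat_def)
qed (use D.lam_hom D.rho_hom D.assoc_hom in \<open>simp_all add: horizontal_bicat_def S.on_obj T.on_obj
    I.on_obj globular_Cod hcomp_Ident D.src_hid_obj D.tgt_hid_obj in_hom_def globular_iso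
    D.lam_iso D.lam_globular D.rho_iso D.rho_globular D.assoc_iso D.assoc_globular\<close>)

lemma decorated_bicategory_decorated_horizontalization:
  "decorated_bicategory (decorated_horizontalization C)"
  by (intro decorated_bicategory.intro)
    (simp_all add: decorated_horizontalization_def bicategory_horizontal_bicat S.D.category_axioms,
      simp add: horizontal_bicat_def)

end

text \<open>Settles the agreement clause of \<open>internalization\<close>, where the
  horizontalization is compared with itself; the content lies in the other two clauses.\<close>

lemma same_deco_bicat_refl: "same_deco_bicat E E"
  by (simp add: same_deco_bicat_def same_bicat_def same_cat_def)



section \<open>Formal expressions\<close>

context decorated_bicategory
begin

abbreviation U where "U \<equiv> underlying D"
abbreviation W where "W \<equiv> cells (underlying D)"
abbreviation K where "K \<equiv> decoration D"

abbreviation d where "d \<equiv> d_inf D"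
abbreviation c where "c \<equiv> c_inf D"
abbreviation s where "s \<equiv> s_inf D"
abbreviation t where "t \<equiv> t_inf D"
abbreviation E where "E \<equiv> E_inf D"
abbreviation R where "R \<equiv> R_inf D"
abbreviation Q where "Q \<equiv> free_double D"

abbreviation vertical  (infixl "\<bullet>\<^sub>\<infinity>" 70) where "y \<bullet>\<^sub>\<infinity> x \<equiv> vcomp D y x"

sublocale U: bicategory "underlying D" "cells (underlying D)" "hcomp1 (underlying D)"
  "hcomp2 (underlying D)" "Comp (cells (underlying D))" "Ident (cells (underlying D))"
  by (rule underlying_bicategory) (rule reflexive)+
sublocale W: category "cells (underlying D)" by (rule U.cells_category)
sublocale K: category "decoration D" by (rule decoration_category)

text \<open>The normal form condition \<open>mk_path (d x) (entries x) = x\<close> makes \<open>vcomp\<close> strictly unital and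
  associative. The conditions on \<open>foldl\<close> start from an arbitrary arrow \<open>u\<close> instead of an identity,
  so that they are inherited by concatenations.\<close>

definition well_formed :: "('h, 'c, 'v) expr \<Rightarrow> bool" where
  "well_formed x \<longleftrightarrow> d x \<in> Obj W \<and> c x \<in> Obj W \<and>
     in_hom K (s x) (src0 U (d x)) (src0 U (c x)) \<and>
     in_hom K (t x) (tgt0 U (d x)) (tgt0 U (c x)) \<and>
     mk_path (d x) (entries x) = x \<and>
     (\<forall>u \<in> Arr K. Cod K u = src0 U (d x) \<longrightarrow>
        foldl (\<lambda>u v. Comp K v u) u (map s (entries x)) = Comp K (s x) u) \<and>
     (\<forall>u \<in> Arr K. Cod K u = tgt0 U (d x) \<longrightarrow>
        foldl (\<lambda>u v. Comp K v u) u (map t (entries x)) = Comp K (t x) u)"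

lemma mk_path_simps [simp]:
  "mk_path \<alpha> [] = Path \<alpha> []" "mk_path \<alpha> [x] = x" "mk_path \<alpha> (x # y # xs) = Path \<alpha> (x # y # xs)"
  by (simp_all add: mk_path_def)

lemma src0_Obj [simp]: "f \<in> Obj W \<Longrightarrow> src0 U f \<in> Obj K"
  and tgt0_Obj [simp]: "f \<in> Obj W \<Longrightarrow> tgt0 U f \<in> Obj K"
  by (simp_all add: Obj_decoration U.src0 U.tgt0)

lemma hid1_simps [simp]:
  assumes "a \<in> Obj K"
  shows "hid1 U a \<in> Obj W" "src0 U (hid1 U a) = a" "tgt0 U (hid1 U a) = a"
  using U.hid1 assms by (simp_all add: Obj_decoration)

lemma hcomp1_simps [simp]:
  assumes "f \<in> Obj W" "g \<in> Obj W" "tgt0 U f = src0 U g"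
  shows "hcomp1 U g f \<in> Obj W" "src0 U (hcomp1 U g f) = src0 U f" "tgt0 U (hcomp1 U g f) = tgt0 U g"
  using U.hcomp1 assms by simp_all

lemma hcomp2_simps [simp]:
  assumes "\<phi> \<in> Arr W" "\<psi> \<in> Arr W" "tgt0 U (Dom W \<phi>) = src0 U (Dom W \<psi>)"
  shows "hcomp2 U \<psi> \<phi> \<in> Arr W" "Dom W (hcomp2 U \<psi> \<phi>) = hcomp1 U (Dom W \<psi>) (Dom W \<phi>)"
    "Cod W (hcomp2 U \<psi> \<phi>) = hcomp1 U (Cod W \<psi>) (Cod W \<phi>)"
  using U.hcomp2 assms by (simp_all add: in_hom_def)

lemma src0_Cod [simp]: "\<phi> \<in> Arr W \<Longrightarrow> src0 U (Cod W \<phi>) = src0 U (Dom W \<phi>)"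
  and tgt0_Cod [simp]: "\<phi> \<in> Arr W \<Longrightarrow> tgt0 U (Cod W \<phi>) = tgt0 U (Dom W \<phi>)"
  by (simp_all add: U.src0_cell U.tgt0_cell)

lemma well_formed_simps [simp]:
  assumes "well_formed x"
  shows "d x \<in> Obj W" "c x \<in> Obj W"
    "s x \<in> Arr K" "Dom K (s x) = src0 U (d x)" "Cod K (s x) = src0 U (c x)"
    "t x \<in> Arr K" "Dom K (t x) = tgt0 U (d x)" "Cod K (t x) = tgt0 U (c x)"
    "mk_path (d x) (entries x) = x"
  using assms by (simp_all add: well_formed_def in_hom_def)

lemma foldl_s:
  assumes "well_formed x" "u \<in> Arr K" "Cod K u = src0 U (d x)"
  shows "foldl (\<lambda>u v. Comp K v u) u (map s (entries x)) = Comp K (s x) u"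
  using assms unfolding well_formed_def by blast

lemma foldl_t:
  assumes "well_formed x" "u \<in> Arr K" "Cod K u = tgt0 U (d x)"
  shows "foldl (\<lambda>u v. Comp K v u) u (map t (entries x)) = Comp K (t x) u"
  using assms unfolding well_formed_def by blast

lemma entries_empty:
  assumes "well_formed x" "entries x = []"
  shows "x = Path (d x) []"
  using well_formed_simps(9)[OF assms(1)] assms(2) by simp

lemma well_formed_Cell2 [simp]: "\<phi> \<in> Arr W \<Longrightarrow> well_formed (Cell2 \<phi>)"
  unfolding well_formed_def by (simp add: in_hom_def)

lemma well_formed_HId [simp]: "f \<in> Arr K \<Longrightarrow> well_formed (HId f)"
  unfolding well_formed_def by (simp add: in_hom_def)

lemma well_formed_empty [simp]: "\<alpha> \<in> Obj W \<Longrightarrow> well_formed (Path \<alpha> [])"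
  unfolding well_formed_def by (auto simp: in_hom_def dest: K.Comp_Ident_left)

text \<open>Compare domains and codomains of the two equal vertical arrows \<open>t x\<close> and
  \<open>s y\<close>.\<close>

lemma concatenable:
  assumes "well_formed x" "well_formed y" "t x = s y"
  shows "tgt0 U (d x) = src0 U (d y)" "tgt0 U (c x) = src0 U (c y)"
  using assms by (metis well_formed_simps(4,7), metis well_formed_simps(5,8))

lemma well_formed_Word:
  assumes "well_formed x" "well_formed y" "t x = s y"
  shows "well_formed (Word y x)"
  unfolding well_formed_def using assms concatenable[OF assms] by (simp add: in_hom_def)

section \<open>Vertical composition of normal forms\<close>

lemma vcomp_Path_left [simp]: "well_formed x \<Longrightarrow> Path \<beta> [] \<bullet>\<^sub>\<infinity> x = x"
  and vcomp_Path_right [simp]: "well_formed y \<Longrightarrow> d y = \<beta> \<Longrightarrow> y \<bullet>\<^sub>\<infinity> Path \<beta> [] = y"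
  by (auto simp: vcomp_def)

text \<open>A factor without entries is an empty path, and the composite is the other factor.
  Otherwise the joint list has at least two entries, so \<open>mk_path\<close> does not collapse
  it.\<close>

lemma vcomp_cases:
  assumes "well_formed x" "well_formed y" "c x = d y"
  obtains "x = Path (d y) []" "y \<bullet>\<^sub>\<infinity> x = y"
    | "y = Path (c x) []" "y \<bullet>\<^sub>\<infinity> x = x"
    | "entries x \<noteq> []" "entries y \<noteq> []" "y \<bullet>\<^sub>\<infinity> x = Path (d x) (entries x @ entries y)"
proof -
  consider "entries x = []" | "entries y = []" | "entries x \<noteq> []" "entries y \<noteq> []" by blast
  then show thesis
  proof cases
    case 1
    have x: "x = Path (d y) []"
      using entries_empty[OF assms(1) 1] assms(3) by (metis c_inf.simps(4) last.simps list.map(1))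
    have "y \<bullet>\<^sub>\<infinity> x = y"
      by (subst x) (simp add: assms(2))
    then show thesis
      by (rule that(1)[OF x])
  next
    case 2
    have y: "y = Path (c x) []"
      unfolding assms(3) by (rule entries_empty[OF assms(2) 2])
    have "y \<bullet>\<^sub>\<infinity> x = x"
      by (subst y) (simp add: assms(1))
    then show thesis
      by (rule that(2)[OF y])
  next
    case 3
    then show thesis
      using that(3) by (cases "entries x"; cases "entries y"; cases "tl (entries x)")
        (auto simp: vcomp_def)
  qed
qed

lemma c_inf_entries:
  assumes "well_formed x" "entries x \<noteq> []"
  shows "c x = c (last (entries x))"
proof (cases x)
  case (Path \<alpha> xs)
  then show ?thesis
    using assms by (auto simp: last_map)
qed simp_all

lemma vcomp_simps [simp]:
  assumes "well_formed x" "well_formed y" "c x = d y"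
  shows "d (y \<bullet>\<^sub>\<infinity> x) = d x" "c (y \<bullet>\<^sub>\<infinity> x) = c y"
    "s (y \<bullet>\<^sub>\<infinity> x) = Comp K (s y) (s x)" "t (y \<bullet>\<^sub>\<infinity> x) = Comp K (t y) (t x)"
    "entries (y \<bullet>\<^sub>\<infinity> x) = entries x @ entries y"
proof -
  have "d (y \<bullet>\<^sub>\<infinity> x) = d x \<and> c (y \<bullet>\<^sub>\<infinity> x) = c y \<and> s (y \<bullet>\<^sub>\<infinity> x) = Comp K (s y) (s x) \<and>
    t (y \<bullet>\<^sub>\<infinity> x) = Comp K (t y) (t x) \<and> entries (y \<bullet>\<^sub>\<infinity> x) = entries x @ entries y"
    using assms
  proof (cases rule: vcomp_cases)
    case 1
    have "d x = d y" "s x = Ident K (src0 U (d y))" "t x = Ident K (tgt0 U (d y))" "entries x = []"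
      by (subst 1(1), simp)+
    then show ?thesis
      using assms(2) K.Comp_Ident_right[of "s y"] K.Comp_Ident_right[of "t y"] by (simp add: 1(2))
  next
    case 2
    have "c y = c x" "s y = Ident K (src0 U (c x))" "t y = Ident K (tgt0 U (c x))" "entries y = []"
      by (subst 2(1), simp)+
    then show ?thesis
      using assms(1) K.Comp_Ident_left[of "s x"] K.Comp_Ident_left[of "t x"] by (simp add: 2(2))
  next
    case 3
    \<comment> \<open>The fold over the joint list first absorbs the entries of \<open>x\<close>;
      its result is the starting arrow for the entries of \<open>y\<close>.\<close>
    have "s (y \<bullet>\<^sub>\<infinity> x) = Comp K (s y) (Comp K (s x) (Ident K (src0 U (d x))))"
      using assms by (simp add: 3 foldl_s)
    moreover have "t (y \<bullet>\<^sub>\<infinity> x) = Comp K (t y) (Comp K (t x) (Ident K (tgt0 U (d x))))"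
      using assms by (simp add: 3 foldl_t)
    ultimately show ?thesis
      using assms 3 K.Comp_Ident_right[of "s x"] K.Comp_Ident_right[of "t x"]
      by (simp add: c_inf_entries last_map)
  qed
  then show "d (y \<bullet>\<^sub>\<infinity> x) = d x" "c (y \<bullet>\<^sub>\<infinity> x) = c y"
    "s (y \<bullet>\<^sub>\<infinity> x) = Comp K (s y) (s x)" "t (y \<bullet>\<^sub>\<infinity> x) = Comp K (t y) (t x)"
    "entries (y \<bullet>\<^sub>\<infinity> x) = entries x @ entries y"
    by blast+
qed

lemma well_formed_vcomp [simp]:
  assumes "well_formed x" "well_formed y" "c x = d y"
  shows "well_formed (y \<bullet>\<^sub>\<infinity> x)"
proof -
  have "mk_path (d x) (entries x @ entries y) = y \<bullet>\<^sub>\<infinity> x"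
    by (simp add: vcomp_def)
  then show ?thesis
    unfolding well_formed_def using assms
    by (simp add: in_hom_def foldl_s foldl_t K.Comp_assoc)
qed

text \<open>Both sides normalize the same list of entries at \<open>d x\<close>, so the law reduces
  to associativity of list append.\<close>

lemma vcomp_assoc:
  assumes "well_formed x" "well_formed y" "well_formed z" "c x = d y" "c y = d z"
  shows "(z \<bullet>\<^sub>\<infinity> y) \<bullet>\<^sub>\<infinity> x = z \<bullet>\<^sub>\<infinity> (y \<bullet>\<^sub>\<infinity> x)"
  using assms by (simp add: vcomp_def[of D "z \<bullet>\<^sub>\<infinity> y" x] vcomp_def[of D z "y \<bullet>\<^sub>\<infinity> x"])

section \<open>The levels and the closure of their union\<close>

lemma well_formed_words:
  assumes "\<And>x. x \<in> X \<Longrightarrow> well_formed x" "x \<in> words D X"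
  shows "well_formed x"
  using assms(2) by induction (simp_all add: assms(1) well_formed_Word)

lemma well_formed_paths:
  assumes "\<And>x. x \<in> X \<Longrightarrow> well_formed x" "x \<in> paths D X"
  shows "well_formed x"
  using assms(2) by induction (simp_all add: assms(1))

lemma well_formed_level: "x \<in> E_level D k \<Longrightarrow> well_formed x"
proof (induction k arbitrary: x)
  case 0
  then show ?case
    by (auto simp: generators_def elim!: well_formed_words[rotated])
next
  case (Suc k)
  then show ?case
    using well_formed_words well_formed_paths by (metis E_level.simps(2))
qed

lemma well_formed_E [simp]: "x \<in> E \<Longrightarrow> well_formed x"
  by (auto simp: E_inf_def well_formed_level)

text \<open>A letter \<open>x\<close> is one step from the empty path at \<open>d x\<close>, and
  this composite is \<open>x\<close> itself by the strict unit law.\<close>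

lemma subset_paths:
  assumes "\<And>x. x \<in> X \<Longrightarrow> well_formed x"
  shows "X \<subseteq> paths D X"
proof
  fix x assume "x \<in> X"
  then show "x \<in> paths D X"
    using paths.step[OF paths.empty[where \<alpha> = "d x" and B = D and X = X], of x] assms[of x] by simp
qed

text \<open>Paths grow by one letter at the end, so the induction runs over the later factor
  \<open>q\<close>, and associativity moves its last letter outside.\<close>

lemma paths_vcomp:
  assumes "\<And>x. x \<in> X \<Longrightarrow> well_formed x"
    and "p \<in> paths D X" "q \<in> paths D X" "c p = d q"
  shows "q \<bullet>\<^sub>\<infinity> p \<in> paths D X"
  using assms(3,4)
proof induction
  case (empty \<alpha>)
  then show ?case
    using well_formed_paths[OF assms(1,2)] assms(2) by simp
next
  case (step q x)
  have "well_formed p" "well_formed q" "well_formed x"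
    using assms(1,2) step.hyps well_formed_paths by blast+
  then show ?case
    using step paths.step[where p = "q \<bullet>\<^sub>\<infinity> p" and x = x and B = D and X = X] by (simp add: vcomp_assoc)
qed

lemma paths_level: "paths D (E_level D k) \<subseteq> E_level D (Suc k)"
  by (auto intro: words.letter)

lemma level_paths: "E_level D k \<subseteq> paths D (E_level D k)"
  by (rule subset_paths) (rule well_formed_level)

lemma E_level_mono: "k \<le> l \<Longrightarrow> E_level D k \<subseteq> E_level D l"
  by (rule lift_Suc_mono_le[of "E_level D", OF order_trans[OF level_paths paths_level]])

lemma E_common_level:
  assumes "x \<in> E" "y \<in> E"
  obtains k where "x \<in> E_level D k" "y \<in> E_level D k"
proof -
  obtain k l where "x \<in> E_level D k" "y \<in> E_level D l"
    using assms by (auto simp: E_inf_def)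
  then show thesis
    using that[of "max k l"] E_level_mono[of k "max k l"] E_level_mono[of l "max k l"] by auto
qed

text \<open>Two expressions of a common level are paths over it, hence so is their composite, which
  lies in the next level.\<close>

lemma E_vcomp [simp]:
  assumes "x \<in> E" "y \<in> E" "c x = d y"
  shows "y \<bullet>\<^sub>\<infinity> x \<in> E"
proof -
  obtain k where k: "x \<in> E_level D k" "y \<in> E_level D k"
    by (rule E_common_level[OF assms(1,2)])
  have "x \<in> paths D (E_level D k)" "y \<in> paths D (E_level D k)"
    using k level_paths by blast+
  then have "y \<bullet>\<^sub>\<infinity> x \<in> paths D (E_level D k)"
    by (intro paths_vcomp[OF _ _ _ assms(3)]) (rule well_formed_level)
  then show ?thesis
    using paths_level unfolding E_inf_def by blast
qed

lemma E_Word [simp]: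
  assumes "x \<in> E" "y \<in> E" "t x = s y"
  shows "Word y x \<in> E"
proof -
  obtain k where k: "x \<in> E_level D k" "y \<in> E_level D k"
    by (rule E_common_level[OF assms(1,2)])
  \<comment> \<open>Every level is a set of words over something, so concatenation stays within it;
    the case split on \<open>k\<close> exposes this form.\<close>
  have "Word y x \<in> E_level D k"
    using words.concat[OF _ _ assms(3)] k by (cases k) simp_all
  then show ?thesis
    unfolding E_inf_def by blast
qed

text \<open>Empty paths are not words in the generators; they enter with the first path category,
  that is, in \<open>E_level\<close> 1.\<close>

lemma E_empty [simp]: "\<alpha> \<in> Obj W \<Longrightarrow> Path \<alpha> [] \<in> E"
  using paths_level[of 0] paths.empty[where \<alpha> = \<alpha> and B = D] unfolding E_inf_def by blast

lemma E_Cell2 [simp]: "\<phi> \<in> Arr W \<Longrightarrow> Cell2 \<phi> \<in> E"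
  and E_HId [simp]: "f \<in> Arr K \<Longrightarrow> HId f \<in> E"
  by (auto simp: E_inf_def generators_def intro!: exI[of _ 0] words.letter)

end

section \<open>The free double category\<close>

context decorated_bicategory
begin

abbreviation cls where "cls x \<equiv> R `` {x}"
abbreviation V where "V \<equiv> V_inf D"

section \<open>Constraint 2-cells and boundary invariance of the relation\<close>

lemma inv_arr_simps [simp]:
  assumes "iso_arr W \<phi>"
  shows "inv_arr W \<phi> \<in> Arr W" "Dom W (inv_arr W \<phi>) = Cod W \<phi>" "Cod W (inv_arr W \<phi>) = Dom W \<phi>"
    "Comp W (inv_arr W \<phi>) \<phi> = Ident W (Dom W \<phi>)" "Comp W \<phi> (inv_arr W \<phi>) = Ident W (Cod W \<phi>)"
  using W.inverse_arrows_inv_arr[OF assms] by (simp_all add: inverse_arrows_def in_hom_def)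

lemma lam_simps [simp]:
  assumes "f \<in> Obj W"
  shows "blam U f \<in> Arr W" "Dom W (blam U f) = hcomp1 U (hid1 U (tgt0 U f)) f"
    "Cod W (blam U f) = f" "iso_arr W (blam U f)"
  using U.lam_hom U.lam_iso assms by (simp_all add: in_hom_def)

lemma rho_simps [simp]:
  assumes "f \<in> Obj W"
  shows "brho U f \<in> Arr W" "Dom W (brho U f) = hcomp1 U f (hid1 U (src0 U f))"
    "Cod W (brho U f) = f" "iso_arr W (brho U f)"
  using U.rho_hom U.rho_iso assms by (simp_all add: in_hom_def)

lemma assoc_simps [simp]:
  assumes "f \<in> Obj W" "g \<in> Obj W" "h \<in> Obj W" "tgt0 U h = src0 U g" "tgt0 U g = src0 U f"
  shows "bassoc U f g h \<in> Arr W" "Dom W (bassoc U f g h) = hcomp1 U f (hcomp1 U g h)"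
    "Cod W (bassoc U f g h) = hcomp1 U (hcomp1 U f g) h" "iso_arr W (bassoc U f g h)"
  using U.assoc_hom[OF assms] U.assoc_iso[OF assms] by (simp_all add: in_hom_def)

text \<open>Each generating relation preserves all four boundaries. This makes the relation a
  congruence on parallel arrows and lets source and target descend to classes.\<close>

lemma R_sound:
  assumes "(x, y) \<in> R"
  shows "x \<in> E \<and> y \<in> E \<and> d x = d y \<and> c x = c y \<and> s x = s y \<and> t x = t y"
  using assms
proof induction
  case (vcomp_cells \<phi> \<psi>)
  then show ?case
    using src0_Cod[of \<phi>] tgt0_Cod[of \<phi>] by (simp add: K.Ident_Ident)
next
  case (interchange x1 x2 y1 y2)
  then show ?case
    using well_formed_Word[of x1 x2] well_formed_Word[of y1 y2] by simp
next
  \<comment> \<open>Unitors and their inverses have identities as vertical boundaries, so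
    conjugating by them changes only \<open>d\<close> and \<open>c\<close>, here back to those of
    \<open>x\<close>.\<close>
  case (lam x)
  then have "well_formed x" by simp
  with lam show ?case
    using well_formed_Word[of x "HId (t x)"] K.Comp_Ident_left[of "s x"] K.Comp_Ident_left[of "t x"]
      K.Comp_Ident_right[of "s x"] K.Comp_Ident_right[of "t x"]
    by simp
next
  case (rho x)
  then have "well_formed x" by simp
  with rho show ?case
    using well_formed_Word[of "HId (s x)" x] K.Comp_Ident_left[of "s x"] K.Comp_Ident_left[of "t x"]
      K.Comp_Ident_right[of "s x"] K.Comp_Ident_right[of "t x"]
    by simp
next
  case (assoc x y z)
  then have wf: "well_formed x" "well_formed y" "well_formed z" by simp_all
  \<comment> \<open>The codomain equations serve the associator after the composite, the domain
    equations the one before it.\<close>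
  note con = concatenable[OF wf(1,2) assoc(4)] concatenable[OF wf(2,3) assoc(5)]
  show ?case
    using assoc wf con well_formed_Word[of x y] well_formed_Word[of y z]
      well_formed_Word[of x "Word z y"] well_formed_Word[of "Word y x" z]
      K.Comp_Ident_left[of "s x"] K.Comp_Ident_left[of "t z"]
      K.Comp_Ident_right[of "s x"] K.Comp_Ident_right[of "t z"]
    by simp
qed (auto simp: K.Comp_assoc Obj_decoration)

lemma R_E:
  assumes "(x, y) \<in> R"
  shows "x \<in> E" "y \<in> E" "d x = d y" "c x = c y" "s x = s y" "t x = t y"
  using R_sound[OF assms] by blast+

section \<open>The category of squares\<close>

sublocale F: category "F_inf D"
proof unfold_locales
  show "Comp (F_inf D) (Ident (F_inf D) (Cod (F_inf D) f)) f = f" if "f \<in> Arr (F_inf D)" for f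
    using that by (simp add: F_inf_def)
qed (auto simp: F_inf_def in_hom_def vcomp_assoc)

sublocale F: category_congruence "F_inf D" "R_inf D"
proof unfold_locales
  show "equiv (Arr (F_inf D)) R"
    by (intro equivI) (auto simp: F_inf_def refl_on_def sym_def trans_def dest: R_E(1,2)
        intro: R_inf.refl R_inf.sym R_inf.trans)
  show "Dom (F_inf D) x = Dom (F_inf D) x' \<and> Cod (F_inf D) x = Cod (F_inf D) x'"
    if "(x, x') \<in> R" for x x'
    using R_E[OF that] by (simp add: F_inf_def)
  \<comment> \<open>\<open>vcomp_cong\<close> requires both pairs to be composable; boundary
    invariance supplies the second condition.\<close>
  show "(Comp (F_inf D) y x, Comp (F_inf D) y' x') \<in> R"
    if "(x, x') \<in> R" "(y, y') \<in> R" "Cod (F_inf D) x = Dom (F_inf D) y" for x x' y y'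
    using that R_E[OF that(1)] R_E[OF that(2)] by (simp add: F_inf_def R_inf.vcomp_cong)
qed


sublocale V: category "V_inf D"
  unfolding V_inf_def by (rule F.category_quotient)

lemma V_simps [simp]:
  "Obj V = Obj W"
  "x \<in> E \<Longrightarrow> cls x \<in> Arr V"
  "x \<in> E \<Longrightarrow> Dom V (cls x) = d x"
  "x \<in> E \<Longrightarrow> Cod V (cls x) = c x"
  "x \<in> E \<Longrightarrow> y \<in> E \<Longrightarrow> c x = d y \<Longrightarrow> Comp V (cls y) (cls x) = cls (y \<bullet>\<^sub>\<infinity> x)"
  using F.quotient_Obj F.quotient_Arr[of x] F.quotient_Dom[of x] F.quotient_Cod[of x]
    F.quotient_Comp[of x y]
  by (simp_all add: V_inf_def F_inf_def)

lemma V_Arr_iff: "X \<in> Arr V \<longleftrightarrow> (\<exists>x\<in>E. X = cls x)"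
  using F.quotient_Arr_iff by (simp add: V_inf_def F_inf_def)

lemma cls_eq: "(x, y) \<in> R \<Longrightarrow> cls x = cls y"
  by (rule F.class_eqI)

text \<open>Relation (2) identifies the empty path with the identity 2-cell; in this form identities
  take part in calculations inside the bicategory.\<close>

lemma V_Ident: "\<alpha> \<in> Obj W \<Longrightarrow> Ident V \<alpha> = cls (Cell2 (Ident W \<alpha>))"
  using F.quotient_Ident cls_eq[OF R_inf.Ident_cells] by (simp add: V_inf_def F_inf_def)

lemma V_Ident_Path: "Ident V \<alpha> = cls (Path \<alpha> [])"
  using F.quotient_Ident by (simp add: V_inf_def F_inf_def)

lemma rep_rel: "x \<in> E \<Longrightarrow> (x, class_rep (cls x)) \<in> R"
  using F.class_rep_rel by (simp add: F_inf_def)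

lemma Q_simps [simp]:
  "C0 Q = K" "C1 Q = V"
  "on_obj (srcF Q) = src0 U" "on_obj (tgtF Q) = tgt0 U"
  "on_obj (hidF Q) = hid1 U" "on_arr (hidF Q) f = cls (HId f)"
  "hcomp_obj Q \<beta> \<alpha> = hcomp1 U \<beta> \<alpha>"
  "dlam Q \<alpha> = cls (Cell2 (blam U \<alpha>))" "drho Q \<alpha> = cls (Cell2 (brho U \<alpha>))"
  "dassoc Q \<alpha> \<beta> \<gamma> = cls (Cell2 (bassoc U \<alpha> \<beta> \<gamma>))"
  by (simp_all add: free_double_def hcomp_obj_def)

lemma src_cls [simp]: "x \<in> E \<Longrightarrow> on_arr (srcF Q) (cls x) = s x"
  and tgt_cls [simp]: "x \<in> E \<Longrightarrow> on_arr (tgtF Q) (cls x) = t x"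
  using R_E(5,6)[OF rep_rel] by (simp_all add: free_double_def)

text \<open>Representatives of composable classes are again composable since \<open>s\<close> and
  \<open>t\<close> are invariant, so \<open>hconc_cong\<close> applies.\<close>

lemma hcomp_cls [simp]:
  assumes "x \<in> E" "y \<in> E" "t x = s y"
  shows "hcomp_arr Q (cls y) (cls x) = cls (Word y x)"
proof -
  have "(Word y x, Word (class_rep (cls y)) (class_rep (cls x))) \<in> R"
    using assms rep_rel R_E[OF rep_rel] by (metis R_inf.hconc_cong)
  then show ?thesis
    by (simp add: free_double_def hcomp_arr_def cls_eq)
qed

lemma cls_vcomp_cells:
  assumes "\<phi> \<in> Arr W" "\<psi> \<in> Arr W" "Cod W \<phi> = Dom W \<psi>"
  shows "Comp V (cls (Cell2 \<psi>)) (cls (Cell2 \<phi>)) = cls (Cell2 (Comp W \<psi> \<phi>))"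
  using cls_eq[OF R_inf.vcomp_cells[OF assms]] assms by simp

lemma cls_hconc_cells:
  assumes "\<phi> \<in> Arr W" "\<psi> \<in> Arr W" "tgt0 U (Dom W \<phi>) = src0 U (Dom W \<psi>)"
  shows "hcomp_arr Q (cls (Cell2 \<psi>)) (cls (Cell2 \<phi>)) = cls (Cell2 (hcomp2 U \<psi> \<phi>))"
  using cls_eq[OF R_inf.hconc_cells[OF assms]] assms by simp

lemma iso_cls:
  assumes "iso_arr W \<phi>"
  shows "iso_arr V (cls (Cell2 \<phi>))"
proof -
  have \<phi>: "\<phi> \<in> Arr W"
    using assms by (auto simp: iso_arr_def inverse_arrows_def in_hom_def)
  \<comment> \<open>Composites are to be evaluated in the bicategory by
    \<open>cls_vcomp_cells\<close>; \<open>V_simps(5)\<close> would instead turn them into formal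
    concatenations.\<close>
  have "inverse_arrows V (cls (Cell2 \<phi>)) (cls (Cell2 (inv_arr W \<phi>)))"
    unfolding inverse_arrows_def using assms \<phi>
    by (simp add: in_hom_def V_Ident cls_vcomp_cells del: V_simps(5))
  then show ?thesis
    by (auto simp: iso_arr_def)
qed

lemma globular_cls: "\<phi> \<in> Arr W \<Longrightarrow> globular Q (cls (Cell2 \<phi>))"
  unfolding globular_def by auto

text \<open>Relation (4) of \<open>R_inf\<close> multiplied by the unitor, which cancels its inverse.\<close>

lemma conjugate_cancel:
  assumes "a \<in> E" "\<phi> \<in> Arr W" "iso_arr W \<psi>" "\<psi> \<in> Arr W" "d a = Dom W \<psi>" "c a = Dom W \<phi>"
  shows "Comp V (cls (Cell2 \<phi> \<bullet>\<^sub>\<infinity> a \<bullet>\<^sub>\<infinity> Cell2 (inv_arr W \<psi>))) (cls (Cell2 \<psi>))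
    = Comp V (cls (Cell2 \<phi>)) (cls a)"
proof -
  have "cls (Cell2 \<phi> \<bullet>\<^sub>\<infinity> a \<bullet>\<^sub>\<infinity> Cell2 (inv_arr W \<psi>))
      = Comp V (Comp V (cls (Cell2 \<phi>)) (cls a)) (cls (Cell2 (inv_arr W \<psi>)))"
    using assms by simp
  also have "Comp V \<dots> (cls (Cell2 \<psi>)) = Comp V (Comp V (cls (Cell2 \<phi>)) (cls a))
      (Comp V (cls (Cell2 (inv_arr W \<psi>))) (cls (Cell2 \<psi>)))"
    by (rule V.Comp_assoc) (use assms in simp_all)
  also have "Comp V (cls (Cell2 (inv_arr W \<psi>))) (cls (Cell2 \<psi>)) = Ident V (d a)"
    using assms by (simp add: cls_vcomp_cells V_Ident del: V_simps(5))
  also have "Comp V (Comp V (cls (Cell2 \<phi>)) (cls a)) \<dots> = Comp V (cls (Cell2 \<phi>)) (cls a)"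
    using V.Comp_Ident_right[of "Comp V (cls (Cell2 \<phi>)) (cls a)"] assms by simp
  finally show ?thesis .
qed

section \<open>The structure functors\<close>

lemma src_functor: "is_functor V K (srcF Q)"
  by unfold_locales (auto simp: V_Arr_iff V_Ident_Path in_hom_def)

lemma tgt_functor: "is_functor V K (tgtF Q)"
  by unfold_locales (auto simp: V_Arr_iff V_Ident_Path in_hom_def)

text \<open>Functoriality is imposed by relation (2): \<open>Ident_HId\<close> gives identities and
  \<open>vcomp_HId\<close> composites.\<close>

lemma hid_functor: "is_functor K V (hidF Q)"
proof unfold_locales
  fix a assume "a \<in> Obj K"
  then show "on_arr (hidF Q) (Ident K a) = Ident V (on_obj (hidF Q) a)"
    using cls_eq[OF R_inf.Ident_HId] by (simp add: V_Ident Obj_decoration)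
next
  fix f g assume "f \<in> Arr K" "g \<in> Arr K" "Cod K f = Dom K g"
  then show "on_arr (hidF Q) (Comp K g f) = Comp V (on_arr (hidF Q) g) (on_arr (hidF Q) f)"
    using cls_eq[OF R_inf.vcomp_HId] by simp
qed (auto simp: in_hom_def)

lemma pullback_simps [simp]:
  "(\<alpha>, \<beta>) \<in> Obj (pullback_cat V V (tgtF Q) (srcF Q))
    \<longleftrightarrow> \<alpha> \<in> Obj W \<and> \<beta> \<in> Obj W \<and> tgt0 U \<alpha> = src0 U \<beta>"
  "(X, Y) \<in> Arr (pullback_cat V V (tgtF Q) (srcF Q))
    \<longleftrightarrow> X \<in> Arr V \<and> Y \<in> Arr V \<and> on_arr (tgtF Q) X = on_arr (srcF Q) Y"
  "Dom (pullback_cat V V (tgtF Q) (srcF Q)) (X, Y) = (Dom V X, Dom V Y)"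
  "Cod (pullback_cat V V (tgtF Q) (srcF Q)) (X, Y) = (Cod V X, Cod V Y)"
  "Ident (pullback_cat V V (tgtF Q) (srcF Q)) (\<alpha>, \<beta>) = (Ident V \<alpha>, Ident V \<beta>)"
  "Comp (pullback_cat V V (tgtF Q) (srcF Q)) (X', Y') (X, Y) = (Comp V X' X, Comp V Y' Y)"
  by (simp_all add: pullback_cat_def)

lemma hcomp_pair:
  "on_obj (hcompF Q) (\<alpha>, \<beta>) = hcomp1 U \<beta> \<alpha>" "on_arr (hcompF Q) (X, Y) = hcomp_arr Q Y X"
  by (simp_all add: free_double_def hcomp_arr_def)

lemma hcomp_functor: "is_functor (pullback_cat V V (tgtF Q) (srcF Q)) V (hcompF Q)"
proof (intro is_functor.intro is_functor_axioms.intro)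
  show "category (pullback_cat V V (tgtF Q) (srcF Q))"
    by (rule category_pullback_cat[OF tgt_functor src_functor])
  show "category V" ..
next
  fix p assume "p \<in> Obj (pullback_cat V V (tgtF Q) (srcF Q))"
  then show "on_obj (hcompF Q) p \<in> Obj V"
    by (cases p) (simp add: hcomp_pair)
next
  fix p assume p: "p \<in> Obj (pullback_cat V V (tgtF Q) (srcF Q))"
  show "on_arr (hcompF Q) (Ident (pullback_cat V V (tgtF Q) (srcF Q)) p) = Ident V (on_obj (hcompF Q) p)"
  proof (cases p)
    case (Pair \<alpha> \<beta>)
    \<comment> \<open>Identities are read as identity 2-cells, so relation (3) reduces the claim to
      \<open>hcomp2_Ident\<close>; \<open>hcomp_cls\<close> would form a word instead.\<close>
    then show ?thesis
      using p by (simp add: hcomp_pair V_Ident cls_hconc_cells U.hcomp2_Ident del: hcomp_cls)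
  qed
next
  fix p assume p: "p \<in> Arr (pullback_cat V V (tgtF Q) (srcF Q))"
  then obtain x y where "p = (cls x, cls y)" "x \<in> E" "y \<in> E" "t x = s y"
    by (cases p) (auto simp: V_Arr_iff)
  then show "in_hom V (on_arr (hcompF Q) p)
      (on_obj (hcompF Q) (Dom (pullback_cat V V (tgtF Q) (srcF Q)) p))
      (on_obj (hcompF Q) (Cod (pullback_cat V V (tgtF Q) (srcF Q)) p))"
    by (simp add: hcomp_pair in_hom_def)
next
  fix p q assume pq: "p \<in> Arr (pullback_cat V V (tgtF Q) (srcF Q))"
    "q \<in> Arr (pullback_cat V V (tgtF Q) (srcF Q))"
    "Cod (pullback_cat V V (tgtF Q) (srcF Q)) p = Dom (pullback_cat V V (tgtF Q) (srcF Q)) q"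
  obtain x y where p: "p = (cls x, cls y)" "x \<in> E" "y \<in> E" "t x = s y"
    using pq(1) by (cases p) (auto simp: V_Arr_iff)
  obtain x' y' where q: "q = (cls x', cls y')" "x' \<in> E" "y' \<in> E" "t x' = s y'"
    using pq(2) by (cases q) (auto simp: V_Arr_iff)
  have eq: "c x = d x'" "c y = d y'"
    using pq(3) p q by simp_all
  show "on_arr (hcompF Q) (Comp (pullback_cat V V (tgtF Q) (srcF Q)) q p)
      = Comp V (on_arr (hcompF Q) q) (on_arr (hcompF Q) p)"
    \<comment> \<open>Relation (1), stated on representatives of the two pairs.\<close>
    using p q eq cls_eq[OF R_inf.interchange[of x D y x' y']] by (simp add: hcomp_pair)
qed

section \<open>The double category axioms\<close>

lemma double_category_free_double: "double_category Q"
\<comment> \<open>Goals follow the order of the axioms: 1 to 4 are the functors, 16, 20 and 24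
  naturality of \<lambda>, \<rho> and A, 25 and 26 triangle and pentagon.\<close>
proof (intro double_category.intro, goal_cases)
  case (1)
  show ?case using src_functor by simp
next
  case 2
  show ?case using tgt_functor by simp
next
  case 3
  show ?case using hid_functor by simp
next
  case 4
  show ?case using hcomp_functor by simp
next
  case (16 X)
  then obtain x where x: "x \<in> E" "X = cls x"
    by (auto simp: V_Arr_iff)
  \<comment> \<open>Relation (4) writes the class of \<open>x\<close> as a conjugate by unitors;
    composing with the unitor at \<open>d x\<close> cancels the inverse and leaves the naturality
    square.\<close>
  have "Comp V X (cls (Cell2 (blam U (d x))))
      = Comp V (cls (Cell2 (blam U (c x)))) (cls (Word (HId (t x)) x))"
    unfolding x(2) cls_eq[OF R_inf.lam[OF x(1)]] by (rule conjugate_cancel) (use x in simp_all)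
  then show ?case
    using x by simp
next
  case (20 X)
  then obtain x where x: "x \<in> E" "X = cls x"
    by (auto simp: V_Arr_iff)
  have "Comp V X (cls (Cell2 (brho U (d x))))
      = Comp V (cls (Cell2 (brho U (c x)))) (cls (Word x (HId (s x))))"
    unfolding x(2) cls_eq[OF R_inf.rho[OF x(1)]] by (rule conjugate_cancel) (use x in simp_all)
  then show ?case
    using x by simp
next
  case (24 X Y Z)
  then obtain x y z where xyz: "x \<in> E" "X = cls x" "y \<in> E" "Y = cls y" "z \<in> E" "Z = cls z"
    by (auto simp: V_Arr_iff)
  have "t x = s y" "t y = s z"
    using 24 xyz by simp_all
  then show ?case
    using xyz cls_eq[OF R_inf.assoc[of x D y z]] concatenable[of x y] concatenable[of y z] by simp
next
  \<comment> \<open>Every factor is the class of a 2-cell, so relations (2) and (3) collapse each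
    side to a single 2-cell and the axiom of the bicategory finishes. The pentagon goes the same
    way.\<close>
  case (25 f g)
  then show ?case
    using U.triangle[of f g] by (simp add: V_Ident cls_vcomp_cells cls_hconc_cells del: V_simps(5) hcomp_cls)
next
  case (26 f g h k)
  then show ?case
    using U.pentagon[of f g h k]
    by (simp add: V_Ident cls_vcomp_cells cls_hconc_cells del: V_simps(5) hcomp_cls)
qed (auto simp: V_Arr_iff in_hom_def iso_cls globular_cls)

lemma internalization_free_double: "internalization Q (decorated_horizontalization Q)"
  unfolding internalization_def
  using decorated_bicategory_decorated_horizontalization double_category_free_double
    same_deco_bicat_refl by blast

end

theorem corollary3p4:
  fixes B :: "('o, 'h, 'c, 'v) deco_bicat"
  assumes "decorated_bicategory B"
  shows "internalization (free_double B) (decorated_horizontalization (free_double B))"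
  using assms by (rule decorated_bicategory.internalization_free_double)

end
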